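(* Let $p$ be a prime and $q$ a power of $p$. For $\xi\in\mathbb{F}_q((T^{-1}))$, set $w(\xi)=\limsup_{n\to\infty} w_n(\xi)/n$ and $w^*(\xi)=\limsup_{n\to\infty} w_n^*(\xi)/n$. Call $\xi$ an $A$-number if $w(\xi)=0$; an $S$-number if $0<w(\xi)<\infty$; a $T$-number if $w(\xi)=\infty$ and $w_n(\xi)<\infty$ for every $n\ge1$; a $U$-number if $w(\xi)=\infty$ and $w_n(\xi)=\infty$ for some $n\ge 1$. Define $A^*$-, $S^*$-, $T^*$-, $U^*$-numbers in the same way using $w^*$ and $w_n^*$ in place of $w$ and $w_n$. Then, in $\mathbb{F}_q((T^{-1}))$, the set of $A$-numbers equals the set of $A^*$-numbers, the set of $S$-numbers equals the set of $S^*$-numbers, the set of $T$-numbers equals the set of $T^*$-numbers, and the set of $U$-numbers equals the set of $U^*$-numbers.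
   Context: $\mathbb{F}_q$ is the field with $q$ elements. For a nonzero $\xi=\sum_{k\ge N} a_k T^{-k}\in\mathbb{F}_q((T^{-1}))$ with $a_N\neq 0$, set $|\xi|=q^{-N}$, and $|0|=0$. The height $H(P)$ of $P\in\mathbb{F}_q[T][X]$ is the maximum of the absolute values of its coefficients. An element $\alpha$ of $\mathbb{F}_q((T^{-1}))$ is algebraic if it is a root of a nonzero polynomial in $\mathbb{F}_q[T][X]$; its degree and height $H(\alpha)$ are those of its minimal defining polynomial over $\mathbb{F}_q[T]$. $w_n(\xi)$ is the supremum of the real $w$ such that $0<|P(\xi)|<H(P)^{-w}$ has infinitely many solutions $P\in\mathbb{F}_q[T][X]$ of degree at most $n$. $w_n^*(\xi)$ is the supremum of the real $w^*$ such that $0<|\xi-\alpha|<H(\alpha)^{-w^*-1}$ has infinitely many solutions in algebraic $\alpha\in\mathbb{F}_q((T^{-1}))$ of degree at most $n$. *)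

theory Defs
  imports
    "HOL-Computational_Algebra.Formal_Laurent_Series"
    "HOL-Library.Extended_Real"
    "HOL-Library.Liminf_Limsup"
    "HOL-Library.Cardinality"
begin

text \<open>
  The finite field with \<open>q\<close> elements is a type \<open>'a :: {field, finite}\<close> with \<open>CARD('a) = q\<close>.
  A Laurent series in \<open>1/T\<close> is an element of type \<open>'a fls\<close>: the formal variable
  \<^const>\<open>fls_X\<close> plays the role of \<open>1/T\<close>, so that \<open>T\<close> is \<^const>\<open>fls_X_inv\<close> and the coefficient
  of \<open>T^(-k)\<close> in \<open>\<xi>\<close> is \<open>\<xi> $$ k\<close>. Polynomials in \<open>T\<close> have type \<open>'a poly\<close>, and polynomials
  in \<open>X\<close> over these have type \<open>'a poly poly\<close>.
\<close>

definition abs_fls :: "'a::{field,finite} fls \<Rightarrow> real" where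
  "abs_fls \<xi> = (if \<xi> = 0 then 0 else real CARD('a) powi (- fls_subdegree \<xi>))"

definition fls_of_poly_T :: "'a::{field,finite} poly \<Rightarrow> 'a fls" where
  "fls_of_poly_T a = poly (map_poly fls_const a) fls_X_inv"

definition eval_fls :: "'a::{field,finite} poly poly \<Rightarrow> 'a fls \<Rightarrow> 'a fls" where
  "eval_fls P \<xi> = poly (map_poly fls_of_poly_T P) \<xi>"

definition poly_height :: "'a::{field,finite} poly poly \<Rightarrow> real" where
  "poly_height P = Max ((\<lambda>i. abs_fls (fls_of_poly_T (coeff P i))) ` {..degree P})"

definition algebraic_fls :: "'a::{field,finite} fls \<Rightarrow> bool" where
  "algebraic_fls \<alpha> \<longleftrightarrow> (\<exists>P. P \<noteq> 0 \<and> eval_fls P \<alpha> = 0)"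

text \<open>
  A minimal defining polynomial has least degree among the nonzero polynomials vanishing at
  \<open>\<alpha>\<close> and coprime coefficients. This determines it up to a nonzero constant of the
  finite field; requiring the leading coefficient to be monic in \<open>T\<close> makes it unique and
  affects neither its degree nor its height.
\<close>

definition is_min_poly_fls :: "'a::{field,finite} poly poly \<Rightarrow> 'a fls \<Rightarrow> bool" where
  "is_min_poly_fls P \<alpha> \<longleftrightarrow>
     P \<noteq> 0 \<and> eval_fls P \<alpha> = 0 \<and>
     (\<forall>Q. Q \<noteq> 0 \<and> eval_fls Q \<alpha> = 0 \<longrightarrow> degree P \<le> degree Q) \<and>
     (\<forall>c. (\<forall>i. c dvd coeff P i) \<longrightarrow> c dvd 1) \<and>
     lead_coeff (lead_coeff P) = 1"

definition min_poly_fls :: "'a::{field,finite} fls \<Rightarrow> 'a poly poly" where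
  "min_poly_fls \<alpha> = (THE P. is_min_poly_fls P \<alpha>)"

definition alg_degree :: "'a::{field,finite} fls \<Rightarrow> nat" where
  "alg_degree \<alpha> = degree (min_poly_fls \<alpha>)"

definition alg_height :: "'a::{field,finite} fls \<Rightarrow> real" where
  "alg_height \<alpha> = poly_height (min_poly_fls \<alpha>)"

definition w_exp :: "nat \<Rightarrow> 'a::{field,finite} fls \<Rightarrow> ereal" where
  "w_exp n \<xi> = Sup {ereal w | w.
     infinite {P. degree P \<le> n \<and>
       0 < abs_fls (eval_fls P \<xi>) \<and> abs_fls (eval_fls P \<xi>) < poly_height P powr (- w)}}"

definition w_star_exp :: "nat \<Rightarrow> 'a::{field,finite} fls \<Rightarrow> ereal" where
  "w_star_exp n \<xi> = Sup {ereal w | w.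
     infinite {\<alpha>. algebraic_fls \<alpha> \<and> alg_degree \<alpha> \<le> n \<and>
       0 < abs_fls (\<xi> - \<alpha>) \<and> abs_fls (\<xi> - \<alpha>) < alg_height \<alpha> powr (- w - 1)}}"

text \<open>
  The four classes are defined for an arbitrary family of exponents \<open>v\<close>, so that Mahler's
  (\<open>v = w_exp\<close>) and Koksma's (\<open>v = w_star_exp\<close>) classifications share one definition.
  The value at \<open>n = 0\<close> is irrelevant for the upper limit.
\<close>

definition exp_growth :: "(nat \<Rightarrow> 'b \<Rightarrow> ereal) \<Rightarrow> 'b \<Rightarrow> ereal" where
  "exp_growth v \<xi> = limsup (\<lambda>n. v n \<xi> / ereal (real n))"

definition A_class :: "(nat \<Rightarrow> 'b \<Rightarrow> ereal) \<Rightarrow> 'b set" where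
  "A_class v = {\<xi>. exp_growth v \<xi> = 0}"

definition S_class :: "(nat \<Rightarrow> 'b \<Rightarrow> ereal) \<Rightarrow> 'b set" where
  "S_class v = {\<xi>. 0 < exp_growth v \<xi> \<and> exp_growth v \<xi> < \<infinity>}"

definition T_class :: "(nat \<Rightarrow> 'b \<Rightarrow> ereal) \<Rightarrow> 'b set" where
  "T_class v = {\<xi>. exp_growth v \<xi> = \<infinity> \<and> (\<forall>n\<ge>1. v n \<xi> < \<infinity>)}"

definition U_class :: "(nat \<Rightarrow> 'b \<Rightarrow> ereal) \<Rightarrow> 'b set" where
  "U_class v = {\<xi>. exp_growth v \<xi> = \<infinity> \<and> (\<exists>n\<ge>1. v n \<xi> = \<infinity>)}"

end

(*
  w*_n <= max 0 w_n because a number alpha near xi makes its minimal polynomial small at xi.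
  Conversely, let P be a prime polynomial with a small value at xi. If |P'(xi)|^2 exceeds H(P) |P(xi)|
  up to a constant, Hensel's lemma gives a root of P in the field of Laurent series at distance
  |P(xi)/P'(xi)| from xi. When w_n >= 4n this condition always holds: the resultant of P with P', or
  with the T-derivative of P if P is inseparable, is a nonzero polynomial in T and so has absolute
  value at least 1. Hence w*_n >= (w_n - 1)/2 in this range, so w_n and w*_n, and the two upper
  limits, are infinite together. For transcendental xi, Wirsing's argument with the resultant of
  two coprime polynomials that are small at xi gives w*_n >= n/2 - 1, so both limits are positive;
  for algebraic xi Liouville's inequality bounds w_n, and both limits vanish.
*)
theory Submission
  imports Defs "Subresultants.Resultant_Prelim" "Berlekamp_Zassenhaus.Unique_Factorization_Poly"
    "HOL-Real_Asymp.Real_Asymp"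
begin

(* With this equivalence declared iff, blast and auto loop on goals about prime elements. *)
declare prime_elem_iff_irreducible [iff del]

section \<open>The absolute value\<close>

text \<open>The approximations must lie in the field of Laurent series itself, so a polynomial that
  is small at \<xi> helps only if |P'(\<xi>)| is not too small; the resultants serve to guarantee
  this. They are estimated without splitting fields: shifting X by \<xi> keeps the Sylvester
  determinant and turns its entries into Taylor coefficients at \<xi>, whose smallness is extracted
  by weights on rows and columns. If Newton's criterion fails, |P'(\<xi>)| is at most the square
  root of A |P(\<xi>)|, with A about H(P). The resultant then bounds 1 by A^(2n-1) times this root,
  and squaring gives A^(4n-1) |P(\<xi>)| \<ge> 1: hence the threshold 4n. If it holds, |\<xi> -
  \<alpha>|^2 \<le> |P(\<xi>)| / A, about H^(-w-1); so w* + 1 = (w + 1) / 2, which is the source of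
  (w - 1) / 2. In Wirsing's argument the square is below H^(-n), which gives n/2 - 1. Below the
  threshold w*_n is bounded from below only in terms of n. This is enough, because a class records
  only whether the limit is zero, positive and finite, or infinite, and whether some exponent is
  infinite.\<close>

lemma power_int_le_iff:
  assumes "1 < (x :: real)"
  shows "x powi m \<le> x powi n \<longleftrightarrow> m \<le> n"
  using assms power_int_increasing[of m n x] power_int_strict_increasing[of n m x] by fastforce

lemma card_gt_1: "CARD('a::{field,finite}) > 1"
proof -
  have "card {0, 1 :: 'a} \<le> CARD('a)" by (intro card_mono) auto
  then show ?thesis by simp
qed

lemma abs_fls_0 [simp]: "abs_fls 0 = 0"
  by (simp add: abs_fls_def)

lemma abs_fls_nonneg [simp]: "0 \<le> abs_fls x"
  by (simp add: abs_fls_def)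

lemma abs_fls_pos_iff [simp]: "0 < abs_fls x \<longleftrightarrow> x \<noteq> 0"
  by (simp add: abs_fls_def)

lemma abs_fls_eq_0_iff [simp]: "abs_fls x = 0 \<longleftrightarrow> x = 0"
  by (simp add: abs_fls_def)

lemma abs_fls_1 [simp]: "abs_fls 1 = 1"
  by (simp add: abs_fls_def)

lemma abs_fls_mult: "abs_fls (x * y :: 'a::{field,finite} fls) = abs_fls x * abs_fls y"
  by (simp add: abs_fls_def power_int_diff power_int_minus field_simps)

lemma abs_fls_power: "abs_fls (x ^ n) = abs_fls x ^ n"
  by (induction n) (simp_all add: abs_fls_mult)

lemma abs_fls_minus [simp]: "abs_fls (- x) = abs_fls x"
  by (simp add: abs_fls_def)

lemma abs_fls_divide: "abs_fls (x / y) = abs_fls x / abs_fls (y :: 'a::{field,finite} fls)"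
proof (cases "y = 0")
  case False
  then have "abs_fls (x / y) * abs_fls y = abs_fls x" by (simp flip: abs_fls_mult)
  with False show ?thesis by (simp add: field_simps)
qed simp

lemma abs_fls_prod: "abs_fls (prod f A) = (\<Prod>i\<in>A. abs_fls (f i))"
  by (induction A rule: infinite_finite_induct) (simp_all add: abs_fls_mult)

text \<open>Turns a bound on the size into vanishing of coefficients; the ultrametric inequality,
  the bound for derivatives and the pigeonhole count in Dirichlet's theorem are read off
  coefficientwise.\<close>

lemma abs_fls_le_powi_iff:
  "abs_fls (x :: 'a::{field,finite} fls) \<le> real CARD('a) powi k \<longleftrightarrow> (\<forall>i. i < - k \<longrightarrow> fls_nth x i = 0)"
proof (cases "x = 0")
  case False
  have "abs_fls x \<le> real CARD('a) powi k \<longleftrightarrow> - k \<le> fls_subdegree x"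
    using False card_gt_1[where 'a='a] by (simp add: abs_fls_def power_int_le_iff minus_le_iff)
  also have "\<dots> \<longleftrightarrow> (\<forall>i. i < - k \<longrightarrow> fls_nth x i = 0)"
    using False nth_fls_subdegree_nonzero[of x]
    by (auto intro: fls_subdegree_geI)
  finally show ?thesis .
qed simp

lemma abs_fls_add_le: "abs_fls (x + y) \<le> max (abs_fls x) (abs_fls (y :: 'a::{field,finite} fls))"
proof (cases "x = 0 \<or> y = 0")
  case False
  let ?k = "max (- fls_subdegree x) (- fls_subdegree y)"
  have "abs_fls (x + y) \<le> real CARD('a) powi ?k"
    unfolding abs_fls_le_powi_iff by auto
  also have "\<dots> = max (abs_fls x) (abs_fls y)"
    using False card_gt_1[where 'a='a]
    by (auto simp: abs_fls_def max_def power_int_le_iff)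
  finally show ?thesis .
qed auto

lemma abs_fls_add_leI: "abs_fls x \<le> B \<Longrightarrow> abs_fls y \<le> B \<Longrightarrow> abs_fls (x + y) \<le> B"
  using abs_fls_add_le[of x y] by simp

lemma abs_fls_sum_le: "0 \<le> B \<Longrightarrow> (\<And>i. i \<in> A \<Longrightarrow> abs_fls (f i) \<le> B) \<Longrightarrow> abs_fls (sum f A) \<le> B"
  by (induction A rule: infinite_finite_induct) (auto intro!: abs_fls_add_leI)

section \<open>Embedding polynomials in \<open>T\<close> into Laurent series\<close>

lemma fls_of_poly_T_nth:
  "fls_nth (fls_of_poly_T a) n = (if n \<le> 0 then coeff a (nat (- n)) else 0)"
proof -
  have "fls_nth (fls_of_poly_T a) n = (\<Sum>i\<le>degree a. coeff a i * (if n = - int i then 1 else 0))"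
    by (simp add: fls_of_poly_T_def poly_altdef degree_map_poly coeff_map_poly fls_nth_sum)
  also have "\<dots> = (\<Sum>i\<le>degree a. if i = nat (- n) then (if n \<le> 0 then coeff a i else 0) else 0)"
    by (intro sum.cong) auto
  also have "\<dots> = (if n \<le> 0 then coeff a (nat (- n)) else 0)"
    by (auto simp: coeff_eq_0)
  finally show ?thesis .
qed

interpretation fls_of_poly_T: inj_idom_hom "fls_of_poly_T :: 'a::{field,finite} poly \<Rightarrow> 'a fls"
proof -
  interpret c: comm_ring_hom "fls_const :: 'a \<Rightarrow> 'a fls"
    by standard (simp_all add: fls_plus_const fls_const_mult_const)
  interpret m: map_poly_comm_ring_hom "fls_const :: 'a \<Rightarrow> 'a fls" ..
  show "inj_idom_hom (fls_of_poly_T :: 'a poly \<Rightarrow> 'a fls)"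
  proof
    fix a b :: "'a poly"
    show "fls_of_poly_T 0 = (0 :: 'a fls)" "fls_of_poly_T 1 = (1 :: 'a fls)"
      by (auto simp: fls_of_poly_T_def)
    show "fls_of_poly_T (a + b) = fls_of_poly_T a + fls_of_poly_T b"
      by (rule fls_eqI) (auto simp: fls_of_poly_T_nth)
    show "fls_of_poly_T (a * b) = fls_of_poly_T a * fls_of_poly_T b"
      by (simp add: fls_of_poly_T_def m.hom_mult)
    show "a = 0" if "fls_of_poly_T a = 0"
    proof (rule poly_eqI)
      fix i show "coeff a i = coeff 0 i"
        using arg_cong[OF that, of "\<lambda>f. fls_nth f (- int i)"] by (simp add: fls_of_poly_T_nth)
    qed
  qed
qed

interpretation map_fls_of_poly_T: map_poly_inj_idom_hom "fls_of_poly_T :: 'a::{field,finite} poly \<Rightarrow> 'a fls" ..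

lemma abs_fls_of_poly_T:
  "a \<noteq> 0 \<Longrightarrow> abs_fls (fls_of_poly_T a :: 'a::{field,finite} fls) = real CARD('a) ^ degree a"
proof -
  assume "a \<noteq> 0"
  then have "fls_subdegree (fls_of_poly_T a) = - int (degree a)"
    by (intro fls_subdegree_eqI) (auto simp: fls_of_poly_T_nth coeff_eq_0)
  with \<open>a \<noteq> 0\<close> show ?thesis by (simp add: abs_fls_def)
qed

lemma abs_fls_of_poly_T_le_iff:
  "abs_fls (fls_of_poly_T a :: 'a::{field,finite} fls) \<le> real CARD('a) ^ h \<longleftrightarrow> degree a \<le> h"
  using card_gt_1[where 'a='a] by (cases "a = 0") (auto simp: abs_fls_of_poly_T power_increasing_iff)

lemma abs_fls_of_poly_T_ge_1: "a \<noteq> 0 \<Longrightarrow> 1 \<le> abs_fls (fls_of_poly_T a :: 'a::{field,finite} fls)"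
  using card_gt_1[where 'a='a] by (auto simp: abs_fls_of_poly_T)

section \<open>Resultants\<close>

lemma sum_lessThan_add: "(\<Sum>i<a + b. f i) = (\<Sum>i<a. f i) + (\<Sum>i<b. f (a + i :: nat) :: 'a::comm_monoid_add)"
  by (induction b) (simp_all add: add.assoc)

lemma prod_lessThan_add: "(\<Prod>i<a + b. f i) = (\<Prod>i<a. f i) * (\<Prod>i<b. f (a + i :: nat) :: 'a::comm_monoid_mult)"
  by (induction b) (simp_all add: mult.assoc)

text \<open>The Sylvester matrix with columns in ascending powers of X, so the determinant is the
  resultant up to sign. Column 0 then holds the constant terms, which after the shift are the values
  at \<xi>.\<close>

definition sylv :: "'a::comm_ring_1 poly \<Rightarrow> 'a poly \<Rightarrow> 'a mat" where
  "sylv P Q = mat (degree Q + degree P) (degree Q + degree P)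
     (\<lambda>(i, j). coeff (if i < degree Q then monom 1 i * P else monom 1 (i - degree Q) * Q) j)"

lemma sylv_carrier [simp]: "sylv P Q \<in> carrier_mat (degree Q + degree P) (degree Q + degree P)"
  by (simp add: sylv_def)

text \<open>A vector in the left kernel is a relation A P + B Q = 0 with deg B < deg P. Then P
  divides B Q, hence B, which forces B = 0 and A = 0. Primality of P lets this run over the integral
  domain, without its fraction field.\<close>

lemma det_sylv_nonzero:
  fixes P Q :: "'a::idom poly"
  assumes P: "prime_elem P" "degree P > 0" and Q: "\<not> P dvd Q"
  shows "det (sylv P Q) \<noteq> 0"
proof
  let ?a = "degree Q" and ?b = "degree P"
  let ?N = "?a + ?b"
  assume "det (sylv P Q) = 0"
  then have "det (transpose_mat (sylv P Q)) = 0"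
    using det_transpose[OF sylv_carrier] by metis
  then obtain v where v: "v \<in> carrier_vec ?N" "v \<noteq> 0\<^sub>v ?N" "transpose_mat (sylv P Q) *\<^sub>v v = 0\<^sub>v ?N"
    using det_0_iff_vec_prod_zero[of "transpose_mat (sylv P Q)" ?N] by auto
  define A where "A = (\<Sum>i<?a. monom (v $ i) i)"
  define B where "B = (\<Sum>i<?b. monom (v $ (?a + i)) i)"
  have degA: "A = 0 \<or> degree A < ?a" unfolding A_def
    by (cases "?a = 0") (auto intro!: degree_sum_less intro: le_less_trans[OF degree_monom_le])
  have degB: "degree B < ?b" unfolding B_def
    using P by (auto intro!: degree_sum_less intro: le_less_trans[OF degree_monom_le])
  have "A * P + B * Q = 0"
  proof (rule poly_eqI)
    fix j
    show "coeff (A * P + B * Q) j = coeff 0 j"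
    proof (cases "j < ?N")
      case True
      have "0 = (transpose_mat (sylv P Q) *\<^sub>v v) $ j" using v(3) True by simp
      also have "\<dots> = (\<Sum>i<?N. v $ i * sylv P Q $$ (i, j))"
        using True v(1) by (simp add: scalar_prod_def sylv_def atLeast0LessThan mult.commute)
      also have "\<dots> = (\<Sum>i<?a. v $ i * sylv P Q $$ (i, j)) + (\<Sum>i<?b. v $ (?a + i) * sylv P Q $$ (?a + i, j))"
        by (rule sum_lessThan_add)
      also have "\<dots> = coeff (A * P + B * Q) j"
        using True by (auto simp: A_def B_def sylv_def sum_distrib_right coeff_sum coeff_monom_mult
            intro!: arg_cong2[where f = "(+)"] sum.cong)
      finally show ?thesis by simp
    next
      case False
      have "degree (B * Q) < ?N"
        using degB degree_mult_le[of B Q] by linarith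
      moreover have "A * P = 0 \<or> degree (A * P) < ?N"
        using degA degree_mult_le[of A P] by auto
      ultimately show ?thesis using False by (auto simp: coeff_eq_0)
    qed
  qed
  then have AB: "A * P = - (B * Q)" by (simp add: eq_neg_iff_add_eq_0)
  then have "P dvd B * Q" by (metis dvd_minus_iff dvd_triv_right)
  with P Q have "P dvd B" by (auto simp: prime_elem_dvd_mult_iff)
  with degB have B: "B = 0" using dvd_imp_degree_le[of P B] by force
  with AB P have A: "A = 0" by auto
  have "v = 0\<^sub>v ?N"
  proof (rule eq_vecI)
    fix i assume "i < dim_vec (0\<^sub>v ?N)"
    then have i: "i < ?N" by simp
    show "v $ i = 0\<^sub>v ?N $ i"
    proof (cases "i < ?a")
      case True
      have "v $ i = coeff A i" using True by (simp add: A_def coeff_sum)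
      with A i show ?thesis by simp
    next
      case False
      have "v $ (?a + (i - ?a)) = coeff B (i - ?a)" using False i by (simp add: B_def coeff_sum)
      with B i False show ?thesis by simp
    qed
  qed (use v in auto)
  with v show False by simp
qed

text \<open>An injective homomorphism preserves degrees, so both matrices have the same size and
  agree entry by entry.\<close>

lemma (in inj_comm_ring_hom) det_sylv_hom:
  "det (sylv (map_poly hom P) (map_poly hom Q)) = hom (det (sylv P Q))"
proof -
  have m: "map_poly hom (monom 1 i * R) = monom 1 i * map_poly hom R" for i R
    by (intro poly_eqI) (simp add: coeff_monom_mult)
  have "sylv (map_poly hom P) (map_poly hom Q) = map_mat hom (sylv P Q)"
    by (rule eq_matI) (auto simp: sylv_def m[symmetric] coeff_map_poly)
  then show ?thesis by (simp only: hom_det)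
qed

lemma coeff_pcompose:
  assumes "degree F < N"
  shows "coeff (pcompose F G) j = (\<Sum>k<N. coeff F k * coeff (G ^ k) j)"
proof -
  have "pcompose F G = (\<Sum>k\<le>degree F. Polynomial.smult (coeff F k) (G ^ k))"
    by (simp add: pcompose_altdef poly_altdef degree_map_poly coeff_map_poly)
  also have "\<dots> = (\<Sum>k<N. Polynomial.smult (coeff F k) (G ^ k))"
    using assms by (intro sum.mono_neutral_left) (auto simp: coeff_eq_0)
  finally show ?thesis by (simp add: coeff_sum)
qed

lemma coeff_mult_expand:
  fixes F P :: "'a::comm_ring_1 poly"
  assumes "degree F < N"
  shows "coeff (F * P) j = (\<Sum>k<N. coeff F k * coeff (monom 1 k * P) j)"
proof -
  \<comment> \<open>Naming the coefficients keeps \<open>F\<close> off the right-hand side of its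
    expansion, so that the substitution below hits only the factor \<open>F\<close>.\<close>
  define c where "c = coeff F"
  have "F = (\<Sum>k\<le>degree F. monom (c k) k)"
    by (simp add: poly_as_sum_of_monoms c_def)
  also have "\<dots> = (\<Sum>k<N. monom (c k) k)"
    using assms by (intro sum.mono_neutral_left) (auto simp: coeff_eq_0 c_def)
  finally have F: "F = (\<Sum>k<N. monom (c k) k)" .
  show ?thesis
    unfolding c_def[symmetric] by (subst F) (auto simp: sum_distrib_right coeff_sum coeff_monom_mult intro!: sum.cong)
qed

text \<open>Replacing \<open>X\<close> by \<open>X + x\<close> multiplies the matrix on both sides by unitriangular matrices.\<close>

lemma det_sylv_translate:
  fixes P Q :: "'a::idom poly"
  shows "det (sylv (pcompose P [:x, 1:]) (pcompose Q [:x, 1:])) = det (sylv P Q)"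
proof -
  let ?a = "degree Q" and ?b = "degree P"
  let ?N = "?a + ?b"
  define L where "L = [:x, 1:]"
  have degL: "degree L = 1" by (simp add: L_def)
  \<comment> \<open>Multiplying a row of coefficients by \<open>T\<close> substitutes L = X + x.
    \<open>U\<close> is block diagonal: it re-expands the factors L^i in powers of X, separately for
    the rows of P and those of Q.\<close>
  define T where "T = mat ?N ?N (\<lambda>(i, j). coeff (L ^ i) j)"
  define U where "U = mat ?N ?N (\<lambda>(i, j). if i < ?a then (if j < ?a then coeff (L ^ i) j else 0)
     else if j < ?a then 0 else coeff (L ^ (i - ?a)) (j - ?a))"
  define S where "S = sylv (pcompose P L) (pcompose Q L)"
  have carr: "T \<in> carrier_mat ?N ?N" "U \<in> carrier_mat ?N ?N" "S \<in> carrier_mat ?N ?N"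
    by (simp_all add: T_def U_def S_def sylv_def degL)
  have deg: "degree (L ^ i) = i" for i unfolding L_def by (rule degree_linear_power)
  have lead: "coeff (L ^ i) i = 1" for i unfolding L_def by (rule coeff_linear_power)
  have detT: "det T = 1"
    by (subst det_lower_triangular[OF _ carr(1)])
       (auto simp: T_def deg coeff_eq_0 lead prod_list_diag_prod)
  have detU: "det U = 1"
    by (subst det_lower_triangular[OF _ carr(2)])
       (auto simp: U_def deg coeff_eq_0 lead prod_list_diag_prod intro!: prod.neutral)
  have comp: "pcompose (monom 1 i * R) L = L ^ i * pcompose R L" for i and R :: "'a poly"
  proof -
    have "pcompose (monom 1 i) L = L ^ i"
      by (induction i) (simp_all add: monom_Suc pcompose_pCons L_def)
    then show ?thesis by (simp add: pcompose_mult)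
  qed
  have degm: "degree (monom 1 i * R) < ?N" if "i + degree R < ?N" for i and R :: "'a poly"
    using that by (intro le_less_trans[OF degree_mult_le]) (simp add: degree_monom_eq)
  have "sylv P Q * T = U * S"
  proof (rule eq_matI)
    fix i j assume "i < dim_row (U * S)" "j < dim_col (U * S)"
    then have ij: "i < ?N" "j < ?N" using carr by auto
    let ?R = "if i < ?a then monom 1 i * P else monom 1 (i - ?a) * Q"
    have "(sylv P Q * T) $$ (i, j) = (\<Sum>k<?N. coeff ?R k * coeff (L ^ k) j)"
      using ij by (simp add: T_def sylv_def scalar_prod_def atLeast0LessThan)
    also have "\<dots> = coeff (pcompose ?R L) j"
      using ij by (intro coeff_pcompose[symmetric]) (auto intro!: degm)
    also have "\<dots> = (U * S) $$ (i, j)"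
    proof (cases "i < ?a")
      case True
      have "(U * S) $$ (i, j) = (\<Sum>k<?N. U $$ (i, k) * S $$ (k, j))"
        using ij carr by (simp add: scalar_prod_def atLeast0LessThan)
      also have "\<dots> = (\<Sum>k<?a. U $$ (i, k) * S $$ (k, j))"
        using True ij by (intro sum.mono_neutral_right) (auto simp: U_def)
      also have "\<dots> = (\<Sum>k<?a. coeff (L ^ i) k * coeff (monom 1 k * pcompose P L) j)"
        using True ij by (intro sum.cong) (auto simp: U_def S_def sylv_def degL)
      also have "\<dots> = coeff (L ^ i * pcompose P L) j"
        using True by (intro coeff_mult_expand[symmetric]) (simp add: deg)
      finally show ?thesis using True by (simp add: comp)
    next
      case False
      have "(U * S) $$ (i, j) = (\<Sum>k<?N. U $$ (i, k) * S $$ (k, j))"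
        using ij carr by (simp add: scalar_prod_def atLeast0LessThan)
      also have "\<dots> = (\<Sum>k\<in>{?a..<?N}. U $$ (i, k) * S $$ (k, j))"
        using False ij by (intro sum.mono_neutral_right) (auto simp: U_def)
      also have "\<dots> = (\<Sum>k<?b. U $$ (i, k + ?a) * S $$ (k + ?a, j))"
        by (rule sum.reindex_bij_witness[of _ "\<lambda>k. k + ?a" "\<lambda>k. k - ?a"]) auto
      also have "\<dots> = (\<Sum>k<?b. coeff (L ^ (i - ?a)) k * coeff (monom 1 k * pcompose Q L) j)"
        using False ij by (intro sum.cong) (auto simp: U_def S_def sylv_def degL)
      also have "\<dots> = coeff (L ^ (i - ?a) * pcompose Q L) j"
        using False ij by (intro coeff_mult_expand[symmetric]) (auto simp: deg)
      finally show ?thesis using False by (simp add: comp)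
    qed
    finally show "(sylv P Q * T) $$ (i, j) = (U * S) $$ (i, j)" .
  qed (use carr in \<open>auto simp: sylv_def\<close>)
  then have "det (sylv P Q) * det T = det U * det S"
    using carr by (metis det_mult sylv_carrier)
  then show ?thesis by (simp add: detT detU S_def L_def)
qed

text \<open>Every term of the permutation expansion meets each row and each column once, so the
  weights give the same bound for all terms, and the ultrametric inequality adds no factor
  n!.\<close>

lemma abs_det_le:
  fixes A :: "'a::{field,finite} fls mat"
  assumes A: "A \<in> carrier_mat n n"
    and nonneg: "\<And>i. i < n \<Longrightarrow> 0 \<le> r i" "\<And>j. j < n \<Longrightarrow> 0 \<le> c j"
    and le: "\<And>i j. i < n \<Longrightarrow> j < n \<Longrightarrow> abs_fls (A $$ (i, j)) \<le> r i * c j"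
  shows "abs_fls (det A) \<le> (\<Prod>i<n. r i) * (\<Prod>j<n. c j)"
  unfolding det_def'[OF A]
proof (rule abs_fls_sum_le)
  show "0 \<le> (\<Prod>i<n. r i) * (\<Prod>j<n. c j)"
    using nonneg by (intro mult_nonneg_nonneg prod_nonneg) auto
  fix p assume "p \<in> {p. p permutes {0..<n}}"
  then have p: "p permutes {..<n}" by (simp add: atLeast0LessThan)
  have "abs_fls (signof p * (\<Prod>i = 0..<n. A $$ (i, p i))) = (\<Prod>i<n. abs_fls (A $$ (i, p i)))"
    by (simp add: abs_fls_mult abs_fls_prod sign_def atLeast0LessThan)
  also have "\<dots> \<le> (\<Prod>i<n. r i * c (p i))"
    using permutes_in_image[OF p] by (intro prod_mono) (auto intro!: le)
  also have "\<dots> = (\<Prod>i<n. r i) * (\<Prod>i<n. c (p i))"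
    by (simp add: prod.distrib)
  also have "(\<Prod>i<n. c (p i)) = (\<Prod>i<n. c i)"
    using prod.permute[OF p, of c] by (simp add: o_def)
  finally show "abs_fls (signof p * (\<Prod>i = 0..<n. A $$ (i, p i))) \<le> (\<Prod>i<n. r i) * (\<Prod>j<n. c j)" .
qed

text \<open>Coefficient i is the i-th Hasse derivative of P at \<xi>, which makes sense in
  characteristic p, where division by i! may fail.\<close>

definition taylor :: "'a::{field,finite} poly poly \<Rightarrow> 'a fls \<Rightarrow> 'a fls poly" where
  "taylor P \<xi> = pcompose (map_poly fls_of_poly_T P) [:\<xi>, 1:]"

lemma degree_taylor [simp]: "degree (taylor P \<xi>) = degree P"
  by (simp add: taylor_def degree_pcompose)

text \<open>By translation invariance the determinant is a nonzero polynomial in T, hence of size at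
  least 1. The row weights \<alpha>, \<beta> and the column weights \<gamma> stay free: each use
  picks those that extract the smallness at hand.\<close>

theorem resultant_inequality:
  fixes P Q :: "'a::{field,finite} poly poly"
  assumes P: "prime_elem P" "degree P > 0" and Q: "\<not> P dvd Q"
    and nonneg: "\<And>s. 0 \<le> \<alpha> s" "\<And>s. 0 \<le> \<beta> s" "\<And>c. 0 \<le> \<gamma> c"
    and boundP: "\<And>s i. s < degree Q \<Longrightarrow> abs_fls (coeff (taylor P \<xi>) i) \<le> \<alpha> s * \<gamma> (s + i)"
    and boundQ: "\<And>s i. s < degree P \<Longrightarrow> abs_fls (coeff (taylor Q \<xi>) i) \<le> \<beta> s * \<gamma> (s + i)"
  shows "1 \<le> (\<Prod>s<degree Q. \<alpha> s) * (\<Prod>s<degree P. \<beta> s) * (\<Prod>c<degree Q + degree P. \<gamma> c)"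
proof -
  let ?a = "degree Q" and ?b = "degree P"
  let ?S = "sylv (taylor P \<xi>) (taylor Q \<xi>)"
  let ?r = "\<lambda>i. if i < ?a then \<alpha> i else \<beta> (i - ?a)"
  have "det ?S = fls_of_poly_T (det (sylv P Q))"
    unfolding taylor_def det_sylv_translate by (rule fls_of_poly_T.det_sylv_hom)
  then have "1 \<le> abs_fls (det ?S)"
    using abs_fls_of_poly_T_ge_1[OF det_sylv_nonzero[OF P Q]] by simp
  also have "\<dots> \<le> (\<Prod>i<?a + ?b. ?r i) * (\<Prod>j<?a + ?b. \<gamma> j)"
  proof (rule abs_det_le[where r = ?r and c = \<gamma>])
    show "?S \<in> carrier_mat (?a + ?b) (?a + ?b)" by (simp add: sylv_def)
    fix i j assume ij: "i < ?a + ?b" "j < ?a + ?b"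
    show "abs_fls (?S $$ (i, j)) \<le> ?r i * \<gamma> j"
      using ij nonneg boundP[of i "j - i"] boundQ[of "i - ?a" "j - (i - ?a)"]
      by (auto simp: sylv_def coeff_monom_mult)
  qed (use nonneg in auto)
  also have "(\<Prod>i<?a + ?b. ?r i) = (\<Prod>s<?a. \<alpha> s) * (\<Prod>s<?b. \<beta> s)"
    by (simp add: prod_lessThan_add)
  finally show ?thesis .
qed

section \<open>Hensel's lemma\<close>

lemma fps_X_power_dvd_iff:
  "fps_X ^ k dvd (f :: 'a::field fps) \<longleftrightarrow> (\<forall>i<k. fps_nth f i = 0)"
proof (cases "f = 0")
  case False
  then have "fps_X ^ k dvd f \<longleftrightarrow> k \<le> subdegree f" by (simp add: fps_dvd_iff)
  also have "\<dots> \<longleftrightarrow> (\<forall>i<k. fps_nth f i = 0)"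
    using False by (auto intro: subdegree_geI nth_less_subdegree_zero)
  finally show ?thesis .
qed simp

lemma diff_dvd_poly_diff: "(x - y :: 'a::comm_ring_1) dvd poly h x - poly h y"
proof (induction h)
  case (pCons a h)
  have "poly (pCons a h) x - poly (pCons a h) y = (x - y) * poly h x + y * (poly h x - poly h y)"
    by (simp add: algebra_simps)
  with pCons show ?case by auto
qed simp

text \<open>The map z to c + X h(z) is an X-adic contraction, so the coefficients of its iterates
  from 0 stabilise.\<close>

lemma fps_fixed_point:
  fixes c :: "'a::field fps"
  obtains z where "z = c + fps_X * poly h z"
proof -
  define G where "G z = c + fps_X * poly h z" for z
  have step: "fps_X ^ Suc k dvd G x - G y" if "fps_X ^ k dvd x - y" for k x y
  proof -
    have "fps_X ^ k dvd poly h x - poly h y"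
      using that diff_dvd_poly_diff[of x y h] by (rule dvd_trans)
    moreover have "G x - G y = fps_X * (poly h x - poly h y)" by (simp add: G_def algebra_simps)
    ultimately show ?thesis by (simp add: mult_dvd_mono)
  qed
  define w where "w k = (G ^^ k) 0" for k
  \<comment> \<open>Coefficient n no longer changes from iterate n + 1 on.\<close>
  define z where "z = Abs_fps (\<lambda>n. fps_nth (w (Suc n)) n)"
  have w_Suc: "fps_X ^ k dvd w (Suc k) - w k" for k
    by (induction k) (use step in \<open>auto simp: w_def\<close>)
  have stable: "fps_nth (w (Suc i + j)) i = fps_nth (w (Suc i)) i" for i j
  proof (induction j)
    case (Suc j)
    have "fps_nth (w (Suc (Suc i + j)) - w (Suc i + j)) i = 0"
      using w_Suc[of "Suc i + j"] by (subst (asm) fps_X_power_dvd_iff) auto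
    with Suc show ?case by simp
  qed simp
  have "fps_X ^ k dvd z - w k" for k
    unfolding fps_X_power_dvd_iff
  proof (intro allI impI)
    fix i assume "i < k"
    then obtain j where "k = Suc i + j" by (metis less_natE add_Suc)
    then show "fps_nth (z - w k) i = 0" using stable[of i j] by (simp add: z_def)
  qed
  then have w_lim: "fps_X ^ k dvd z - w k" for k .
  have "fps_X ^ Suc k dvd z - G z" for k
  proof -
    have "w (Suc k) = G (w k)" by (simp add: w_def)
    then have "z - G z = (z - w (Suc k)) - (G z - G (w k))" by simp
    then show ?thesis using dvd_diff[OF w_lim[of "Suc k"] step[OF w_lim[of k]]] by simp
  qed
  then have "fps_nth (z - G z) k = 0" for k
    unfolding fps_X_power_dvd_iff by blast
  then have "z = G z" by (intro fps_ext) simp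
  then show ?thesis using that by (simp add: G_def)
qed

lemma abs_fls_less_1_imp:
  assumes "abs_fls (x :: 'a::{field,finite} fls) < 1"
  obtains d where "x = fls_X * fps_to_fls d"
proof (cases "x = 0")
  case False
  have "\<not> fls_subdegree x \<le> 0"
  proof
    assume "fls_subdegree x \<le> 0"
    then have "real CARD('a) powi 0 \<le> real CARD('a) powi (- fls_subdegree x)"
      using card_gt_1[where 'a='a] by (subst power_int_le_iff) auto
    with assms False show False by (simp add: abs_fls_def)
  qed
  then have "0 \<le> fls_subdegree (x / fls_X)" using False by (simp add: fls_divide_subdegree)
  then have "x = fls_X * fps_to_fls (fls_regpart (x / fls_X))"
    by (subst fls_regpart_to_fls_trivial) (auto simp: fls_X_times_conv_shift)
  then show ?thesis by (rule that)
qed (use that[of 0] in simp)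

text \<open>Put y = e z with e = p_0 / p_1 and divide by p_0: the equation becomes 1 + z + (sum over
  i \<ge> 2 of c_i z^i) = 0. Here c_i = p_i e^i / p_0 = p_i e^(i-2) e / p_1 has size below 1 by the
  hypothesis, so it is divisible by 1/T and z is the fixed point of a contraction. Its constant term
  -1 gives |z| = 1.\<close>

lemma hensel:
  fixes p :: "'a::{field,finite} fls poly"
  assumes B: "\<And>i. abs_fls (coeff p i) \<le> B"
    and p0: "coeff p 0 \<noteq> 0"
    and p1: "B * abs_fls (coeff p 0) < abs_fls (coeff p 1) ^ 2"
  obtains y where "poly p y = 0" "y \<noteq> 0" "abs_fls y = abs_fls (coeff p 0) / abs_fls (coeff p 1)"
proof -
  have B_ge_0: "0 \<le> B" using B[of 0] abs_fls_nonneg order_trans by blast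
  have p1_nz: "coeff p 1 \<noteq> 0" using p1 B_ge_0 abs_fls_nonneg[of "coeff p 0"] by (auto simp: mult_less_0_iff not_less simp del: abs_fls_nonneg)
  define e where "e = coeff p 0 / coeff p 1"
  have e_nz: "e \<noteq> 0" using p0 p1_nz by (simp add: e_def)
  have e_less: "B * abs_fls e < abs_fls (coeff p 1)"
    using p1 p1_nz by (simp add: e_def abs_fls_divide divide_simps power2_eq_square)
  have "B * abs_fls e < B" using e_less B[of 1] by linarith
  then have e_le_1: "abs_fls e < 1" using B_ge_0 mult_left_mono[of 1 "abs_fls e" B] by (cases "1 \<le> abs_fls e") auto
  have "\<exists>d. coeff p i * e ^ i / coeff p 0 = fls_X * fps_to_fls d" if "i \<ge> 2" for i
  proof -
    have "coeff p i * e ^ i / coeff p 0 = coeff p i * e ^ (i - 2) * e / coeff p 1"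
      using that p0 p1_nz by (simp add: e_def power_diff power2_eq_square)
    then have "abs_fls (coeff p i * e ^ i / coeff p 0)
        = abs_fls (coeff p i) * abs_fls e ^ (i - 2) * abs_fls e / abs_fls (coeff p 1)"
      by (simp add: abs_fls_mult abs_fls_divide abs_fls_power)
    also have "\<dots> \<le> B * 1 * abs_fls e / abs_fls (coeff p 1)"
      using B[of i] e_le_1 B_ge_0
      by (intro divide_right_mono mult_right_mono mult_mono) (auto intro: power_le_one)
    also have "\<dots> < 1" using e_less p1_nz by (simp add: divide_simps)
    finally show ?thesis by (metis abs_fls_less_1_imp)
  qed
  then obtain d where d: "i \<ge> 2 \<Longrightarrow> coeff p i * e ^ i / coeff p 0 = fls_X * fps_to_fls (d i)" for i
    by metis
  define h where "h = - (\<Sum>i=2..degree p. monom (d i) i)"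
  obtain z where z: "z = - 1 + fps_X * poly h z" by (rule fps_fixed_point)
  let ?z = "fps_to_fls z"
  have deg: "degree p \<ge> 1" using p1_nz le_degree by blast
  have "poly h z = - (\<Sum>i=2..degree p. d i * z ^ i)" by (simp add: h_def poly_sum poly_monom)
  then have z_eq: "z = - 1 - fps_X * (\<Sum>i=2..degree p. d i * z ^ i)" using z by simp
  have sum_hom: "fps_to_fls (sum f A) = (\<Sum>i\<in>A. fps_to_fls (f i))" for f :: "nat \<Rightarrow> 'a fps" and A
    by (induction A rule: infinite_finite_induct) simp_all
  from z_eq have "?z = - 1 - fls_X * fps_to_fls (\<Sum>i=2..degree p. d i * z ^ i)"
    by (metis (no_types, lifting) fls_times_fps_to_fls fps_X_to_fls fps_one_to_fls fps_to_fls_minus fps_to_fls_uminus)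
  also have "fps_to_fls (\<Sum>i=2..degree p. d i * z ^ i) = (\<Sum>i=2..degree p. fps_to_fls (d i) * ?z ^ i)"
    by (simp add: sum_hom fls_times_fps_to_fls fps_to_fls_power)
  finally have "?z = - 1 - (\<Sum>i=2..degree p. (fls_X * fps_to_fls (d i)) * ?z ^ i)"
    by (simp only: sum_distrib_left mult.assoc)
  moreover have "x + 1 + s = 0" if "x = - 1 - s" for x s :: "'a fls" using that by simp
  ultimately have "?z + 1 + (\<Sum>i=2..degree p. (fls_X * fps_to_fls (d i)) * ?z ^ i) = 0" by blast
  also have "(\<Sum>i=2..degree p. (fls_X * fps_to_fls (d i)) * ?z ^ i)
      = (\<Sum>i=2..degree p. coeff p i * e ^ i * ?z ^ i) / coeff p 0"
    by (simp add: sum_divide_distrib flip: d)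
  finally have "coeff p 0 + coeff p 0 * ?z + (\<Sum>i=2..degree p. coeff p i * (e * ?z) ^ i) = 0"
    using p0 by (simp add: field_simps power_mult_distrib)
  moreover have "coeff p 0 = coeff p 1 * e" using p1_nz by (simp add: e_def)
  moreover have "poly p (e * ?z) = coeff p 0 + coeff p 1 * (e * ?z) + (\<Sum>i=2..degree p. coeff p i * (e * ?z) ^ i)"
  proof -
    have "{..degree p} = insert 0 (insert 1 {2..degree p})" using deg by auto
    then show ?thesis by (simp add: poly_altdef)
  qed
  ultimately have root: "poly p (e * ?z) = 0" by (simp add: mult.assoc)
  have "fps_nth z 0 = - 1" by (subst z) simp
  then have "?z \<noteq> 0" "fls_subdegree ?z = 0"
    by (auto simp: fls_subdegree_fls_to_fps)
  then have "abs_fls ?z = 1" by (simp add: abs_fls_def)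
  with \<open>?z \<noteq> 0\<close> e_nz show ?thesis
    by (intro that[OF root]) (auto simp: e_def abs_fls_mult abs_fls_divide)
qed

section \<open>Heights\<close>

text \<open>The degree in T, which for nonzero P is the base-q logarithm of the height.\<close>

definition hdeg :: "'a::{field,finite} poly poly \<Rightarrow> nat" where
  "hdeg P = Max ((\<lambda>i. degree (coeff P i)) ` {..degree P})"

lemma degree_coeff_le_hdeg: "degree (coeff P i) \<le> hdeg P"
proof (cases "i \<le> degree P")
  case False
  then show ?thesis by (simp add: coeff_eq_0)
qed (auto simp: hdeg_def)

lemma hdeg_leI: "(\<And>i. degree (coeff P i) \<le> h) \<Longrightarrow> hdeg P \<le> h"
  by (simp add: hdeg_def)

lemma hdeg_attained:
  assumes "P \<noteq> 0"
  obtains i where "coeff P i \<noteq> 0" "degree (coeff P i) = hdeg P"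
proof (cases "hdeg P = 0")
  case True
  with assms that[of "degree P"] show ?thesis
    using degree_coeff_le_hdeg[of P "degree P"] by simp
next
  case False
  have "hdeg P \<in> (\<lambda>i. degree (coeff P i)) ` {..degree P}"
    unfolding hdeg_def by (rule Max_in) auto
  with False that show ?thesis by force
qed

lemma abs_coeff_le_height: "abs_fls (fls_of_poly_T (coeff P i)) \<le> poly_height P"
proof (cases "i \<le> degree P")
  case False
  then have "coeff P i = 0" by (simp add: coeff_eq_0)
  then show ?thesis
    unfolding poly_height_def by (subst Max_ge_iff) auto
qed (auto simp: poly_height_def)

lemma poly_height_nonneg [simp]: "0 \<le> poly_height P"
  using abs_coeff_le_height[of P 0] abs_fls_nonneg order_trans by blast

lemma poly_height_0 [simp]: "poly_height 0 = 0"
  by (simp add: poly_height_def)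

lemma poly_height_eq:
  assumes "P \<noteq> 0"
  shows "poly_height P = real CARD('a) ^ hdeg (P :: 'a::{field,finite} poly poly)"
proof (rule antisym)
  show "poly_height P \<le> real CARD('a) ^ hdeg P"
    by (simp add: poly_height_def abs_fls_of_poly_T_le_iff degree_coeff_le_hdeg)
  obtain i where "coeff P i \<noteq> 0" "degree (coeff P i) = hdeg P" using hdeg_attained[OF assms] .
  then show "real CARD('a) ^ hdeg P \<le> poly_height P"
    using abs_coeff_le_height[of P i] by (simp add: abs_fls_of_poly_T)
qed

lemma poly_height_ge_1: "P \<noteq> 0 \<Longrightarrow> 1 \<le> poly_height (P :: 'a::{field,finite} poly poly)"
  using card_gt_1[where 'a='a] by (simp add: poly_height_eq)

lemma poly_height_le_iff:
  "P \<noteq> 0 \<Longrightarrow> poly_height (P :: 'a::{field,finite} poly poly) \<le> real CARD('a) ^ h \<longleftrightarrow> hdeg P \<le> h"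
  using card_gt_1[where 'a='a] by (simp add: poly_height_eq)

lemma coeff_mult_top:
  fixes a b :: "'a::comm_semiring_0 poly"
  assumes "degree a \<le> h" "degree b \<le> k"
  shows "coeff (a * b) (h + k) = coeff a h * coeff b k"
proof (cases "degree a = h \<and> degree b = k")
  case True
  then show ?thesis using coeff_mult_degree_sum[of a b] by simp
next
  case False
  with assms have "degree a < h \<or> degree b < k" by linarith
  moreover from this assms degree_mult_le[of a b] have "degree (a * b) < h + k" by linarith
  ultimately show ?thesis by (auto simp: coeff_eq_0)
qed

text \<open>The coefficient of the highest power of \<open>T\<close> is multiplicative, which gives Gauss's lemma
  for the height.\<close>

lemma hdeg_mult:
  assumes "P \<noteq> 0" "Q \<noteq> 0"
  shows "hdeg (P * Q) = hdeg P + hdeg Q"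
proof -
  define top where "top h R = map_poly (\<lambda>a. coeff a h) R" for h and R :: "'a poly poly"
  have nz: "top (hdeg R) R \<noteq> 0" if R: "R \<noteq> 0" for R
  proof -
    obtain i where "coeff R i \<noteq> 0" "degree (coeff R i) = hdeg R" using hdeg_attained[OF R] .
    then have "coeff (top (hdeg R) R) i \<noteq> 0" by (simp add: top_def coeff_map_poly flip: \<open>_ = hdeg R\<close>)
    then show ?thesis by auto
  qed
  let ?h = "hdeg P + hdeg Q"
  have "top ?h (P * Q) = top (hdeg P) P * top (hdeg Q) Q"
    by (rule poly_eqI)
       (simp add: top_def coeff_map_poly coeff_mult[of P] coeff_mult[of "map_poly _ P"] coeff_sum
          coeff_mult_top degree_coeff_le_hdeg)
  with nz[OF assms(1)] nz[OF assms(2)] have "top ?h (P * Q) \<noteq> 0" by simp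
  then obtain i where "coeff (coeff (P * Q) i) ?h \<noteq> 0"
    by (metis (no_types, lifting) coeff_0 coeff_map_poly poly_eqI top_def)
  then have "?h \<le> degree (coeff (P * Q) i)" by (rule le_degree)
  then have "?h \<le> hdeg (P * Q)" using degree_coeff_le_hdeg order_trans by blast
  moreover have "hdeg (P * Q) \<le> ?h"
  proof (rule hdeg_leI)
    fix i
    have "degree (coeff P j * coeff Q (i - j)) \<le> ?h" for j
      by (intro order_trans[OF degree_mult_le] add_mono degree_coeff_le_hdeg)
    then show "degree (coeff (P * Q) i) \<le> ?h"
      unfolding coeff_mult by (intro degree_sum_le) auto
  qed
  ultimately show ?thesis by simp
qed

lemma poly_height_mult: "poly_height (P * Q) = poly_height P * poly_height Q"
  by (cases "P = 0 \<or> Q = 0") (auto simp: poly_height_eq hdeg_mult power_add)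

lemma poly_height_dvd_le:
  assumes "P dvd Q" "Q \<noteq> 0"
  shows "poly_height P \<le> poly_height Q"
proof -
  obtain R where R: "Q = P * R" using assms by auto
  with assms have "1 \<le> poly_height R" by (intro poly_height_ge_1) auto
  with R show ?thesis using mult_left_mono[of 1 "poly_height R" "poly_height P"]
    by (simp add: poly_height_mult)
qed

text \<open>Used twice: for polynomials in T over the finite field, then for polynomials in X with
  coefficients in the finite set so obtained.\<close>

lemma finite_bounded_poly:
  fixes A :: "'a::comm_monoid_add set"
  assumes "finite A"
  shows "finite {P. degree P \<le> n \<and> (\<forall>i. coeff P i \<in> A)}"
proof (rule finite_subset)
  show "{P. degree P \<le> n \<and> (\<forall>i. coeff P i \<in> A)} \<subseteq>
      (\<lambda>c. \<Sum>i\<le>n. monom (c i) i) ` ({..n} \<rightarrow>\<^sub>E A)"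
  proof (intro subsetI)
    fix P :: "'a poly" assume P: "P \<in> {P. degree P \<le> n \<and> (\<forall>i. coeff P i \<in> A)}"
    then have "P = (\<Sum>i\<le>n. monom (restrict (coeff P) {..n} i) i)"
      by (simp add: poly_as_sum_of_monoms')
    with P show "P \<in> (\<lambda>c. \<Sum>i\<le>n. monom (c i) i) ` ({..n} \<rightarrow>\<^sub>E A)"
      by (intro image_eqI[where x = "restrict (coeff P) {..n}"]) auto
  qed
qed (use assms in \<open>auto intro: finite_PiE\<close>)

lemma finite_bounded_height:
  "finite {P :: 'a::{field,finite} poly poly. degree P \<le> n \<and> poly_height P \<le> B}"
proof -
  obtain h where h: "B \<le> real CARD('a) ^ h"
    using real_arch_pow[of "real CARD('a)" B] card_gt_1[where 'a='a] by (auto intro: less_imp_le)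
  have "finite {a :: 'a poly. degree a \<le> h}"
    using finite_bounded_poly[of "UNIV :: 'a set" h] by simp
  then have fin: "finite {P :: 'a poly poly. degree P \<le> n \<and> (\<forall>i. coeff P i \<in> {a. degree a \<le> h})}"
    by (rule finite_bounded_poly)
  have "degree (coeff P i) \<le> h" if "poly_height P \<le> B" for P :: "'a poly poly" and i
    unfolding abs_fls_of_poly_T_le_iff[symmetric]
    using abs_coeff_le_height[of P i] that h by linarith
  then show ?thesis by (intro finite_subset[OF _ fin]) auto
qed

section \<open>Taylor coefficients\<close>

lemma eval_fls_0 [simp]: "eval_fls 0 \<xi> = 0"
  by (simp add: eval_fls_def)

lemma eval_fls_mult: "eval_fls (P * Q) \<xi> = eval_fls P \<xi> * eval_fls Q \<xi>"
  by (simp add: eval_fls_def map_fls_of_poly_T.hom_mult)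

lemma eval_fls_const: "eval_fls [:a:] \<xi> = fls_of_poly_T a"
  by (simp add: eval_fls_def fls_of_poly_T.map_poly_pCons_hom)

lemma poly_taylor: "poly (taylor P \<xi>) y = eval_fls P (\<xi> + y)"
  by (simp add: taylor_def poly_pcompose eval_fls_def add.commute)

lemma coeff_taylor_0: "coeff (taylor P \<xi>) 0 = eval_fls P \<xi>"
  using poly_taylor[of P \<xi> 0] by (simp add: poly_0_coeff_0)

lemma coeff_taylor_1: "coeff (taylor P \<xi>) 1 = eval_fls (pderiv P) \<xi>"
proof -
  have "coeff (taylor P \<xi>) 1 = poly (pderiv (taylor P \<xi>)) 0"
    by (simp add: poly_0_coeff_0 coeff_pderiv)
  also have "\<dots> = poly (pderiv (map_poly fls_of_poly_T P)) \<xi>"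
    by (simp add: taylor_def pderiv_pcompose poly_pcompose pderiv_pCons)
  also have "pderiv (map_poly fls_of_poly_T P) = map_poly fls_of_poly_T (pderiv P)"
    by (rule poly_eqI) (simp add: coeff_pderiv coeff_map_poly hom_distribs)
  finally show ?thesis by (simp add: eval_fls_def)
qed

lemma abs_coeff_linear_power_le:
  "abs_fls (coeff ([:\<xi>, 1:] ^ k) j) \<le> max 1 (abs_fls \<xi>) ^ k"
proof (induction k arbitrary: j)
  case (Suc k)
  have "abs_fls (coeff ([:\<xi>, 1:] * R) j) \<le> max 1 (abs_fls \<xi>) ^ Suc k"
    if R: "\<And>j. abs_fls (coeff R j) \<le> max 1 (abs_fls \<xi>) ^ k" for R
  proof -
    have "abs_fls (\<xi> * coeff R j) \<le> max 1 (abs_fls \<xi>) ^ Suc k"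
      unfolding power_Suc abs_fls_mult by (intro mult_mono R) auto
    moreover have "abs_fls (coeff R i) \<le> max 1 (abs_fls \<xi>) ^ Suc k" for i
      unfolding power_Suc using mult_mono[OF max.cobounded1[of 1 "abs_fls \<xi>"] R[of i]] by simp
    ultimately show ?thesis
      by (cases j) (auto intro!: abs_fls_add_leI)
  qed
  from this[OF Suc] show ?case by simp
qed (simp add: coeff_1)

text \<open>The factor in front of the height depends only on n and \<xi>, so a slack in the
  exponent or in a tolerance absorbs it.\<close>

lemma abs_coeff_taylor_le:
  assumes "degree P \<le> n"
  shows "abs_fls (coeff (taylor P \<xi>) j) \<le> max 1 (abs_fls \<xi>) ^ n * poly_height P"
proof -
  let ?M = "max 1 (abs_fls \<xi>)"
  have "coeff (taylor P \<xi>) j = (\<Sum>k<Suc n. fls_of_poly_T (coeff P k) * coeff ([:\<xi>, 1:] ^ k) j)"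
    unfolding taylor_def using assms by (subst coeff_pcompose[where N = "Suc n"]) auto
  also have "abs_fls \<dots> \<le> ?M ^ n * poly_height P"
  proof (rule abs_fls_sum_le)
    fix k assume "k \<in> {..<Suc n}"
    then have "abs_fls (coeff ([:\<xi>, 1:] ^ k) j) \<le> ?M ^ n"
      by (intro order_trans[OF abs_coeff_linear_power_le] power_increasing) auto
    then show "abs_fls (fls_of_poly_T (coeff P k) * coeff ([:\<xi>, 1:] ^ k) j) \<le> ?M ^ n * poly_height P"
      unfolding abs_fls_mult mult.commute[of "?M ^ n"] by (intro mult_mono abs_coeff_le_height) auto
  qed simp
  finally show ?thesis .
qed

section \<open>Minimal polynomials\<close>

text \<open>Peels off one prime at a time, to pass from P to a prime factor that inherits a
  property: vanishing at \<alpha>, or being small at \<xi>.\<close>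

lemma ufd_prime_induct [consumes 1, case_names unit prime]:
  fixes P :: "'a::ufd"
  assumes nz: "P \<noteq> 0"
    and unit: "\<And>u. u dvd 1 \<Longrightarrow> R u"
    and prime: "\<And>p x. prime_elem p \<Longrightarrow> x \<noteq> 0 \<Longrightarrow> R x \<Longrightarrow> R (p * x)"
  shows "R P"
proof (cases "P dvd 1")
  case False
  then obtain F where F: "mset_factors F P" using mset_factors_exist[OF nz] by auto
  then have "prod_mset F = P" and prime_F: "\<And>f. f \<in># F \<Longrightarrow> prime_elem f"
    by (auto elim!: mset_factorsE simp: prime_elem_iff_irreducible)
  have "R (prod_mset F) \<and> prod_mset F \<noteq> 0"
    using prime_F
  proof (induction F)
    case (add f F)
    have f: "prime_elem f" by (rule add.prems) simp
    have IH: "R (prod_mset F) \<and> prod_mset F \<noteq> 0" by (rule add.IH, rule add.prems) simp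
    from f have "f \<noteq> 0" by (rule prime_elem_not_zeroI)
    with IH prime[OF f] show ?case by simp
  qed (simp add: unit)
  then show ?thesis using \<open>prod_mset F = P\<close> by simp
qed (rule unit)

lemma prime_root_exists:
  assumes "P \<noteq> 0" "eval_fls P \<alpha> = 0"
  shows "\<exists>F. prime_elem F \<and> F dvd P \<and> eval_fls F \<alpha> = 0"
  using assms
proof (induction P rule: ufd_prime_induct)
  case (unit u)
  from unit(1) obtain v where "1 = u * v" by (rule dvdE)
  then have "eval_fls u \<alpha> * eval_fls v \<alpha> = eval_fls 1 \<alpha>" by (metis eval_fls_mult)
  with unit(2) have "eval_fls 1 \<alpha> = 0" by simp
  then show ?case by (simp add: eval_fls_def)
next
  case (prime p x)
  then consider "eval_fls p \<alpha> = 0" | "eval_fls x \<alpha> = 0" unfolding eval_fls_mult by fastforce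
  then show ?case
  proof cases
    case 1
    with prime(1) show ?thesis by (meson dvd_triv_left)
  next
    case 2
    with prime(3) show ?thesis by (meson dvd_mult)
  qed
qed

text \<open>At a common root \<alpha> both Taylor expansions lack a constant term, so column 0 may
  be given the weight 0, and the resultant inequality would read 1 \<le> 0.\<close>

lemma prime_root_dvd:
  assumes F: "prime_elem F" "eval_fls F \<alpha> = 0" and Q: "eval_fls Q \<alpha> = 0"
  shows "degree F > 0" "F dvd Q"
proof -
  show deg: "degree F > 0"
  proof (rule ccontr)
    assume "\<not> degree F > 0"
    then obtain a where "F = [:a:]" by (metis degree_eq_zeroE neq0_conv)
    with F show False by (auto simp: eval_fls_const)
  qed
  show "F dvd Q"
  proof (rule ccontr)
    assume nd: "\<not> F dvd Q"
    let ?M = "\<lambda>P. max 1 (abs_fls \<alpha>) ^ degree P * poly_height P"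
    let ?\<gamma> = "\<lambda>c :: nat. if c = 0 then 0 else 1 :: real"
    have *: "abs_fls (coeff (taylor P \<alpha>) i) \<le> ?M P * ?\<gamma> (s + i)" if "eval_fls P \<alpha> = 0" for P s i
      using that abs_coeff_taylor_le[of P "degree P" \<alpha> i] abs_coeff_taylor_le[of P "degree P" \<alpha> 0]
      by (cases i) (auto simp: coeff_taylor_0)
    have "1 \<le> (\<Prod>s<degree Q. ?M F) * (\<Prod>s<degree F. ?M Q) * (\<Prod>c<degree Q + degree F. ?\<gamma> c)"
      by (rule resultant_inequality[OF F(1) deg nd, where \<xi> = \<alpha>]) (use * F Q in auto)
    also have "(\<Prod>c<degree Q + degree F. ?\<gamma> c) = 0" using deg by (auto simp: prod_zero_iff)
    finally show False by simp
  qed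
qed

text \<open>A prime of positive degree is primitive: if F = c G, then F divides G because c has
  smaller degree, so c is a unit. The degree is minimal because F divides everything that vanishes
  at \<alpha>.\<close>

lemma is_min_poly_fls_prime:
  assumes F: "prime_elem F" "eval_fls F \<alpha> = 0" "lead_coeff (lead_coeff F) = 1"
  shows "is_min_poly_fls F \<alpha>"
proof -
  note deg = prime_root_dvd(1)[OF F(1,2,2)] and F_dvd = prime_root_dvd(2)[OF F(1,2)]
  have F_nz: "F \<noteq> 0" using deg by auto
  have unit: "\<forall>c. (\<forall>i. c dvd coeff F i) \<longrightarrow> c dvd 1"
  proof (intro allI impI)
    fix c assume "\<forall>i. c dvd coeff F i"
    then have "[:c:] dvd F" by (simp add: const_poly_dvd_iff)
    then obtain G where G: "F = [:c:] * G" by (rule dvdE)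
    have "\<not> F dvd [:c:]"
    proof
      assume "F dvd [:c:]"
      moreover have "[:c:] \<noteq> 0" using F_nz G by (metis mult_zero_left)
      ultimately have "degree F \<le> degree [:c:]" by (rule dvd_imp_degree_le)
      with deg show False by simp
    qed
    moreover have "F dvd [:c:] * G" by (subst G[symmetric]) (rule dvd_refl)
    ultimately have "F dvd G" using prime_elem_dvd_multD[OF F(1)] by blast
    then obtain k where k: "G = F * k" by (rule dvdE)
    have "F * ([:c:] * k) = [:c:] * (F * k)" by (rule mult.left_commute)
    also have "\<dots> = F * 1" unfolding k[symmetric] G[symmetric] by simp
    finally have "[:c:] * k = 1" using F_nz by (simp only: mult_cancel_left) simp
    from arg_cong[OF this, of "\<lambda>f. coeff f 0"] have "c * coeff k 0 = 1" by simp
    then have "1 = c * coeff k 0" by (rule sym)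
    then show "c dvd 1" by (rule dvdI)
  qed
  have "\<forall>Q. Q \<noteq> 0 \<and> eval_fls Q \<alpha> = 0 \<longrightarrow> degree F \<le> degree Q"
  proof (intro allI impI, elim conjE)
    fix Q assume "Q \<noteq> 0" and "eval_fls Q \<alpha> = 0"
    from F_dvd[OF this(2)] this(1) show "degree F \<le> degree Q" by (rule dvd_imp_degree_le)
  qed
  then show ?thesis
    unfolding is_min_poly_fls_def using F(2,3) F_nz unit by (intro conjI)
qed

lemma is_min_poly_fls_unique:
  assumes F: "prime_elem F" "is_min_poly_fls F \<alpha>" and G: "is_min_poly_fls G \<alpha>"
  shows "G = F"
proof -
  have F': "F \<noteq> 0" "eval_fls F \<alpha> = 0" "lead_coeff (lead_coeff F) = 1"
    using F(2) unfolding is_min_poly_fls_def by blast+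
  have G': "G \<noteq> 0" "eval_fls G \<alpha> = 0" "lead_coeff (lead_coeff G) = 1"
    "\<And>c. \<forall>i. c dvd coeff G i \<Longrightarrow> c dvd 1" "degree G \<le> degree F"
    using G F' unfolding is_min_poly_fls_def by blast+
  have "F dvd G" by (rule prime_root_dvd(2)[OF F(1) F'(2) G'(2)])
  then obtain k where k: "G = F * k" by (rule dvdE)
  with F' G' have "degree k = 0" by (auto simp: degree_mult_eq)
  then obtain c where c: "k = [:c:]" by (rule degree_eq_zeroE)
  have "\<forall>i. c dvd coeff G i" using k c by simp
  then have "c dvd 1" by (rule G'(4))
  then obtain d where d: "c = [:d:]" by (metis is_unit_poly_iff)
  have "lead_coeff (lead_coeff G) = lead_coeff (lead_coeff F) * d"
    unfolding k c d by (simp add: lead_coeff_mult)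
  with F'(3) G'(3) have "d = 1" by simp
  then have "k = 1" unfolding c d by simp
  then show ?thesis unfolding k by simp
qed

lemma min_poly_fls_props:
  assumes P: "P \<noteq> 0" "eval_fls P \<alpha> = 0"
  shows "prime_elem (min_poly_fls \<alpha>)" "eval_fls (min_poly_fls \<alpha>) \<alpha> = 0"
proof -
  obtain F0 where F0: "prime_elem F0" "eval_fls F0 \<alpha> = 0" using prime_root_exists[OF P] by (elim exE conjE)
  let ?l = "lead_coeff (lead_coeff F0)"
  have F0_nz: "F0 \<noteq> 0" using F0(1) by (rule prime_elem_not_zeroI)
  then have "1 = [:[:inverse ?l:]:] * [:[:?l:]:]" by simp
  then have unit: "[:[:inverse ?l:]:] dvd 1" by (rule dvdI)
  define F where "F = [:[:inverse ?l:]:] * F0"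
  have F: "prime_elem F" "eval_fls F \<alpha> = 0"
    unfolding F_def eval_fls_mult using F0 prime_elem_mult_unit_left[OF unit, of F0]
    by (simp_all only: mult_zero_right)
  have "lead_coeff (lead_coeff F) = 1"
    using F0_nz unfolding F_def by (simp add: lead_coeff_mult)
  with F have F_min: "is_min_poly_fls F \<alpha>" by (rule is_min_poly_fls_prime)
  have "min_poly_fls \<alpha> = F"
    unfolding min_poly_fls_def using F_min is_min_poly_fls_unique[OF F(1) F_min] by (rule the_equality)
  with F show "prime_elem (min_poly_fls \<alpha>)" "eval_fls (min_poly_fls \<alpha>) \<alpha> = 0"
    by (simp_all only:)
qed

lemma alg_degree_height_le:
  assumes P: "P \<noteq> 0" "eval_fls P \<alpha> = 0"
  shows "alg_degree \<alpha> \<le> degree P" "alg_height \<alpha> \<le> poly_height P" "1 \<le> alg_height \<alpha>"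
proof -
  note m = min_poly_fls_props[OF P]
  have "min_poly_fls \<alpha> \<noteq> 0" using m(1) by (rule prime_elem_not_zeroI)
  moreover have "min_poly_fls \<alpha> dvd P" by (rule prime_root_dvd(2)[OF m P(2)])
  ultimately show "alg_degree \<alpha> \<le> degree P" "alg_height \<alpha> \<le> poly_height P" "1 \<le> alg_height \<alpha>"
    using P(1) by (simp_all add: alg_degree_def alg_height_def dvd_imp_degree_le poly_height_dvd_le poly_height_ge_1)
qed

section \<open>Inseparable polynomials\<close>

lemma prime_CHAR_finite_field: "prime CHAR('a::{field,finite})"
  by (rule prime_CHAR_semidom) (rule finite_imp_CHAR_pos, simp)

lemma finite_field_pth_root: "\<exists>r. (x :: 'a::{field,finite}) = r ^ CHAR('a)"
proof -
  have "inj (\<lambda>r :: 'a. r ^ CHAR('a))"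
  proof (rule injI)
    fix r s :: 'a assume eq: "r ^ CHAR('a) = s ^ CHAR('a)"
    have "((r - s) + s) ^ CHAR('a) = (r - s) ^ CHAR('a) + s ^ CHAR('a)"
      using prime_CHAR_finite_field by (rule freshmans_dream) simp
    with eq have "(r - s) ^ CHAR('a) = 0" by simp
    then show "r = s" by simp
  qed
  then have "surj (\<lambda>r :: 'a. r ^ CHAR('a))" by (intro finite_UNIV_inj_surj) simp_all
  then show ?thesis by (metis surjD)
qed

text \<open>A vanishing derivative leaves only exponents divisible by p, and sums of p-th powers are
  p-th powers. Stated over a domain because it is applied in T and then in X.\<close>

lemma poly_pth_root:
  fixes F :: "'b::idom poly"
  assumes p: "prime CHAR('b)" and F: "pderiv F = 0" and root: "\<And>j. \<exists>r. coeff F j = r ^ CHAR('b)"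
  shows "\<exists>R. F = R ^ CHAR('b)"
proof -
  let ?p = "CHAR('b)"
  obtain r where r: "\<And>j. coeff F j = r j ^ ?p" using root by metis
  have p_dvd: "?p dvd j" if "coeff F j \<noteq> 0" for j
  proof (cases j)
    case (Suc k)
    have "of_nat j * coeff F j = coeff (pderiv F) k" using Suc by (simp add: coeff_pderiv)
    with F that have "of_nat j = (0 :: 'b)" by simp
    then show ?thesis by (simp only: of_nat_eq_0_iff_char_dvd)
  qed simp
  have "F = (\<Sum>j\<le>degree F. monom (coeff F j) j)" by (simp add: poly_as_sum_of_monoms)
  also have "\<dots> = (\<Sum>j\<le>degree F. (monom (r j) (j div ?p)) ^ ?p)"
  proof (intro sum.cong refl)
    fix j
    show "monom (coeff F j) j = (monom (r j) (j div ?p)) ^ ?p"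
    proof (cases "coeff F j = 0")
      case True
      then show ?thesis using r[of j] prime_gt_0_nat[OF p] by (auto simp: power_0_left)
    next
      case False
      then show ?thesis using p_dvd[of j] by (simp add: monom_power r)
    qed
  qed
  also have "\<dots> = (\<Sum>j\<le>degree F. monom (r j) (j div ?p)) ^ ?p"
    by (rule freshmans_dream_sum[symmetric]) (use p in simp_all)
  finally show ?thesis by blast
qed

abbreviation pderiv_T :: "'a::{field,finite} poly poly \<Rightarrow> 'a poly poly" where
  "pderiv_T \<equiv> map_poly pderiv"

text \<open>If both partial derivatives vanish, P is a p-th power, since the finite field is
  perfect; a prime is not.\<close>

lemma prime_elem_pderiv_T_nonzero:
  fixes P :: "'a::{field,finite} poly poly"
  assumes P: "prime_elem P" "pderiv P = 0"
  shows "pderiv_T P \<noteq> 0"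
proof
  assume D: "pderiv_T P = 0"
  have p: "prime CHAR('a)" by (rule prime_CHAR_finite_field)
  have "\<exists>r. coeff P j = r ^ CHAR('a)" for j
  proof (rule poly_pth_root[OF p])
    show "pderiv (coeff P j) = 0" using arg_cong[OF D, of "\<lambda>f. coeff f j"] by (simp add: coeff_map_poly)
  qed (rule finite_field_pth_root)
  then have "\<exists>R. P = R ^ CHAR('a)"
    using poly_pth_root[of P] P p by simp
  then obtain R where R: "P = R ^ CHAR('a)" by blast
  then have "P dvd R ^ CHAR('a)" by simp
  then have "P dvd R" using P(1) by (rule prime_elem_dvd_power[rotated])
  obtain k where k: "R = P * k" using \<open>P dvd R\<close> by (rule dvdE)
  have "CHAR('a) \<ge> 2" using p by (rule prime_ge_2_nat)
  then obtain m where m: "CHAR('a) = Suc (Suc m)" by (metis add_2_eq_Suc le_Suc_ex)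
  have "P * (k * R ^ Suc m) = R * R ^ Suc m" by (simp only: k mult.assoc)
  also have "\<dots> = P * 1" using R m by simp
  finally have "k * R ^ Suc m = 1" using P(1) by (simp only: mult_cancel_left) (auto simp: prime_elem_def)
  then have "1 = R * (k * R ^ m)" by (simp add: algebra_simps)
  also have "\<dots> = P * (k * (k * R ^ m))" by (subst (1) k) (simp only: mult.assoc)
  finally have "P dvd 1" by (rule dvdI)
  with P(1) show False by (simp add: prime_elem_def)
qed

lemma hdeg_pderiv_T_less:
  assumes "pderiv_T P \<noteq> 0"
  shows "hdeg (pderiv_T P) < hdeg P"
proof -
  obtain i where i: "coeff (pderiv_T P) i \<noteq> 0" "degree (coeff (pderiv_T P) i) = hdeg (pderiv_T P)"
    using hdeg_attained[OF assms] .
  then have nz: "pderiv (coeff P i) \<noteq> 0" by (simp add: coeff_map_poly)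
  then have "degree (coeff P i) \<noteq> 0" by (metis degree_eq_zeroE pderiv_singleton)
  then have "degree (pderiv (coeff P i)) < degree (coeff P i)"
    using degree_pderiv_le[of "coeff P i"] by linarith
  then show ?thesis using i(2) degree_coeff_le_hdeg[of P i] by (simp add: coeff_map_poly)
qed

text \<open>The T-derivative may keep the degree in X; what drops is the degree in T, and by Gauss's
  lemma a divisor has no larger height.\<close>

lemma prime_not_dvd_pderiv_T:
  assumes "prime_elem P" "pderiv P = 0"
  shows "\<not> P dvd pderiv_T P"
proof
  assume "P dvd pderiv_T P"
  note nz = prime_elem_pderiv_T_nonzero[OF assms]
  from poly_height_dvd_le[OF \<open>P dvd pderiv_T P\<close> nz] have "hdeg P \<le> hdeg (pderiv_T P)"
    using card_gt_1[where 'a='a] assms(1) nz by (auto simp: poly_height_eq prime_elem_def)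
  with hdeg_pderiv_T_less[OF nz] show False by simp
qed

lemma prime_not_dvd_pderiv:
  fixes P :: "'a::idom poly"
  assumes "prime_elem P" "degree P > 0" "pderiv P \<noteq> 0"
  shows "\<not> P dvd pderiv P"
proof
  assume "P dvd pderiv P"
  then have "degree P \<le> degree (pderiv P)" using assms(3) by (rule dvd_imp_degree_le)
  with degree_pderiv_le[of P] assms(2) show False by linarith
qed

text \<open>\<open>fls_deriv\<close> differentiates in the variable 1/T, and d/d(1/T) = - T^2
  d/dT.\<close>

lemma fls_deriv_of_poly_T: "fls_deriv (fls_of_poly_T a) = - (fls_X_inv ^ 2) * fls_of_poly_T (pderiv a)"
proof (rule fls_eqI)
  fix n :: int
  have "fls_nth (fls_X_inv ^ 2 * fls_of_poly_T (pderiv a)) n = fls_nth (fls_of_poly_T (pderiv a)) (n + 2)"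
    by (simp add: fls_X_inv_power_times_conv_shift)
  also have "\<dots> = - fls_nth (fls_deriv (fls_of_poly_T a)) n"
  proof (cases "n \<le> - 2")
    case True
    then obtain m where m: "n = - 2 - int m"
      by (metis diff_diff_eq2 diff_ge_0_iff_ge diff_add_cancel add_diff_cancel_left' nonneg_int_cases)
    have "nat (- (n + 2)) = m" "nat (- (n + 1)) = Suc m" "of_int (n + 1) = - (of_nat (Suc m) :: 'a)"
      by (simp_all add: m)
    with True show ?thesis by (simp add: fls_of_poly_T_nth coeff_pderiv del: of_nat_Suc)
  next
    case False
    then consider "n = -1" | "n \<ge> 0" by linarith
    then show ?thesis by cases (simp_all add: fls_of_poly_T_nth)
  qed
  finally show "fls_nth (fls_deriv (fls_of_poly_T a)) n =
      fls_nth (- (fls_X_inv ^ 2) * fls_of_poly_T (pderiv a)) n" by simp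
qed

lemma eval_fls_pCons: "eval_fls (pCons a P) \<xi> = fls_of_poly_T a + \<xi> * eval_fls P \<xi>"
  by (simp add: eval_fls_def fls_of_poly_T.map_poly_pCons_hom)

lemma eval_fls_add: "eval_fls (P + Q) \<xi> = eval_fls P \<xi> + eval_fls Q \<xi>"
  by (simp add: eval_fls_def map_fls_of_poly_T.hom_add)

text \<open>The chain rule. For inseparable P the unknown derivative of \<xi> drops out.\<close>

lemma fls_deriv_eval_fls:
  "fls_deriv (eval_fls P \<xi>) = - (fls_X_inv ^ 2) * eval_fls (pderiv_T P) \<xi> + eval_fls (pderiv P) \<xi> * fls_deriv \<xi>"
proof (induction P)
  case (pCons a P)
  have "pderiv_T (pCons a P) = pCons (pderiv a) (pderiv_T P)"
    by (rule poly_eqI) (simp add: coeff_map_poly coeff_pCons split: nat.splits)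
  then show ?case
    by (simp add: eval_fls_pCons eval_fls_add pderiv_pCons fls_deriv_of_poly_T pCons.IH algebra_simps)
qed simp

lemma abs_fls_deriv_le: "abs_fls (fls_deriv x) \<le> real CARD('a) * abs_fls (x :: 'a::{field,finite} fls)"
proof (cases "x = 0")
  case False
  have "abs_fls (fls_deriv x) \<le> real CARD('a) powi (1 - fls_subdegree x)"
    unfolding abs_fls_le_powi_iff by auto
  also have "\<dots> = real CARD('a) * abs_fls x"
    using False by (simp add: abs_fls_def power_int_diff power_int_minus divide_inverse)
  finally show ?thesis .
qed simp

text \<open>The factor T^2 contributes q^2, while differentiating P(\<xi>) costs at most q.\<close>

lemma abs_eval_pderiv_T_le:
  fixes P :: "'a::{field,finite} poly poly"
  assumes "pderiv P = 0"
  shows "abs_fls (eval_fls (pderiv_T P) \<xi>) \<le> abs_fls (eval_fls P \<xi>)"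
proof -
  let ?q = "real CARD('a)"
  have q: "?q > 1" using card_gt_1[where 'a='a] by simp
  have "abs_fls (fls_X_inv :: 'a fls) = ?q" by (simp add: abs_fls_def)
  then have "?q ^ 2 * abs_fls (eval_fls (pderiv_T P) \<xi>) = abs_fls (fls_deriv (eval_fls P \<xi>))"
    by (simp add: fls_deriv_eval_fls assms abs_fls_mult abs_fls_power)
  also have "\<dots> \<le> ?q * abs_fls (eval_fls P \<xi>)" by (rule abs_fls_deriv_le)
  finally have "?q * abs_fls (eval_fls (pderiv_T P) \<xi>) \<le> abs_fls (eval_fls P \<xi>)"
    using q by (simp add: power2_eq_square)
  moreover have "1 * abs_fls (eval_fls (pderiv_T P) \<xi>) \<le> ?q * abs_fls (eval_fls (pderiv_T P) \<xi>)"
    using q by (intro mult_right_mono) auto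
  ultimately show ?thesis by linarith
qed

section \<open>Approximation by roots\<close>

text \<open>Only column 0 contains P(\<xi>) and Q(\<xi>), so the weight e on this column extracts
  their common smallness once.\<close>

lemma resultant_inequality_values:
  fixes P Q :: "'a::{field,finite} poly poly"
  assumes P: "prime_elem P" "degree P > 0" and Q: "\<not> P dvd Q"
    and A: "0 \<le> A" "\<And>i. abs_fls (coeff (taylor P \<xi>) i) \<le> A" "abs_fls (eval_fls P \<xi>) \<le> A * e"
    and B: "0 \<le> B" "\<And>i. abs_fls (coeff (taylor Q \<xi>) i) \<le> B" "abs_fls (eval_fls Q \<xi>) \<le> B * e"
    and e: "0 \<le> e"
  shows "1 \<le> A ^ degree Q * B ^ degree P * e"
proof -
  let ?\<gamma> = "\<lambda>c :: nat. if c = 0 then e else 1"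
  have "1 \<le> (\<Prod>s<degree Q. A) * (\<Prod>s<degree P. B) * (\<Prod>c<degree Q + degree P. ?\<gamma> c)"
  proof (rule resultant_inequality[OF P Q, where \<xi> = \<xi>])
    show "abs_fls (coeff (taylor P \<xi>) i) \<le> A * ?\<gamma> (s + i)" for s i
      using A by (auto simp: coeff_taylor_0)
    show "abs_fls (coeff (taylor Q \<xi>) i) \<le> B * ?\<gamma> (s + i)" for s i
      using B by (auto simp: coeff_taylor_0)
  qed (use A B e in auto)
  also have "(\<Prod>c<degree Q + degree P. ?\<gamma> c) = e"
    using P(2) by (subst prod.delta) auto
  finally show ?thesis by simp
qed

text \<open>With a = |P(\<xi>)| and b = |P'(\<xi>)|, Hensel's root has distance a / b, and the
  criterion bounds a^2 / b^2 by a / A, which removes the unknown b.\<close>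

lemma root_near:
  assumes A: "\<And>i. abs_fls (coeff (taylor P \<xi>) i) \<le> A" "1 \<le> A"
    and nz: "eval_fls P \<xi> \<noteq> 0"
    and newton: "A * abs_fls (eval_fls P \<xi>) < abs_fls (eval_fls (pderiv P) \<xi>) ^ 2"
  obtains \<alpha> where "eval_fls P \<alpha> = 0" "\<alpha> \<noteq> \<xi>" "abs_fls (\<xi> - \<alpha>) ^ 2 \<le> abs_fls (eval_fls P \<xi>) / A"
proof -
  let ?a = "abs_fls (eval_fls P \<xi>)" and ?b = "abs_fls (eval_fls (pderiv P) \<xi>)"
  obtain y where y: "poly (taylor P \<xi>) y = 0" "y \<noteq> 0"
    "abs_fls y = abs_fls (coeff (taylor P \<xi>) 0) / abs_fls (coeff (taylor P \<xi>) 1)"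
    by (rule hensel[OF A(1)]) (use nz newton in \<open>simp_all only: coeff_taylor_0 coeff_taylor_1 not_False_eq_True\<close>)
  have "0 < A * ?a" using A nz by simp
  then have b: "?b ^ 2 > 0" using newton by linarith
  have "abs_fls (\<xi> - (\<xi> + y)) ^ 2 = ?a * ?a / ?b ^ 2"
    using y(3) by (simp only: coeff_taylor_0 coeff_taylor_1) (simp add: power_divide power2_eq_square)
  also have "\<dots> \<le> ?a / A"
    using less_imp_le[OF newton] b A nz by (simp add: divide_simps mult.commute)
  finally show ?thesis
    using y by (intro that[of "\<xi> + y"]) (simp_all add: poly_taylor)
qed

text \<open>An inseparable prime \<open>P\<close> does not exist here: its \<open>T\<close>-derivative \<open>D\<close> is coprime to \<open>P\<close>, and since
  \<open>\<partial>P/\<partial>X = 0\<close> the derivative of the Laurent series \<open>P(\<xi>)\<close> is \<open>D(\<xi>)\<close> up to the factor \<open>T\<^sup>2\<close>, so that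
  \<open>D(\<xi>)\<close> is as small as \<open>P(\<xi>)\<close>, against the bound from their resultant. For a separable \<open>P\<close> the
  resultant of \<open>P\<close> and \<open>\<partial>P/\<partial>X\<close> keeps the derivative at \<open>\<xi>\<close> away from \<open>0\<close>.\<close>

lemma newton_of_small_value:
  fixes P :: "'a::{field,finite} poly poly"
  assumes P: "prime_elem P" "0 < degree P" "degree P \<le> n"
    and A: "max 1 (abs_fls \<xi>) ^ n * poly_height P \<le> A" "1 \<le> A"
    and small: "A ^ (4 * n - 1) * abs_fls (eval_fls P \<xi>) < 1"
  shows "A * abs_fls (eval_fls P \<xi>) < abs_fls (eval_fls (pderiv P) \<xi>) ^ 2"
proof (rule ccontr)
  assume not: "\<not> A * abs_fls (eval_fls P \<xi>) < abs_fls (eval_fls (pderiv P) \<xi>) ^ 2"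
  let ?a = "abs_fls (eval_fls P \<xi>)"
  have P_nz: "P \<noteq> 0" using P(2) by auto
  have bound: "abs_fls (coeff (taylor Q \<xi>) i) \<le> A"
    if "degree Q \<le> degree P" "poly_height Q \<le> poly_height P" for Q i
  proof -
    have "abs_fls (coeff (taylor Q \<xi>) i) \<le> max 1 (abs_fls \<xi>) ^ n * poly_height Q"
      using that P by (intro abs_coeff_taylor_le) simp
    also have "\<dots> \<le> max 1 (abs_fls \<xi>) ^ n * poly_height P"
      using that by (intro mult_left_mono) simp_all
    finally show ?thesis using A(1) by simp
  qed
  have a_le: "?a \<le> A" using bound[of P 0] by (simp add: coeff_taylor_0)
  \<comment> \<open>With e = d / A the bound A e for the values becomes d, and one power of A is
    saved: the exponent is deg P + deg Q - 1.\<close>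
  have *: "1 \<le> A ^ (2 * n - 1) * d"
    if Q: "\<not> P dvd Q" "degree Q \<le> degree P" "poly_height Q \<le> poly_height P" "abs_fls (eval_fls Q \<xi>) \<le> d"
      and d: "?a \<le> d" "0 \<le> d" for Q d
  proof -
    have "1 \<le> A ^ degree Q * A ^ degree P * (d / A)"
      using Q d A(2) bound by (intro resultant_inequality_values[OF P(1,2) Q(1), where \<xi> = \<xi>]) auto
    also have "\<dots> = A ^ (degree Q + degree P - 1) * d"
      using A(2) P(2) by (simp add: power_add power_diff)
    also have "\<dots> \<le> A ^ (2 * n - 1) * d"
      using A(2) P Q d by (intro mult_right_mono power_increasing) auto
    finally show ?thesis .
  qed
  \<comment> \<open>A common form for both cases: d = |P(\<xi>)| for the T-derivative, and d = sqrt
    (A |P(\<xi>)|) for the X-derivative, which the failing criterion bounds by it.\<close>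
  have "\<exists>d\<ge>0. d ^ 2 \<le> A * ?a \<and> 1 \<le> A ^ (2 * n - 1) * d"
  proof (cases "pderiv P = 0")
    case True
    note nz = prime_elem_pderiv_T_nonzero[OF P(1) True]
    have "1 \<le> A ^ (2 * n - 1) * ?a"
    proof (rule *)
      show "\<not> P dvd pderiv_T P" by (rule prime_not_dvd_pderiv_T[OF P(1) True])
      show "degree (pderiv_T P) \<le> degree P" by (rule degree_map_poly_le)
      show "poly_height (pderiv_T P) \<le> poly_height P"
        using hdeg_pderiv_T_less[OF nz] nz P_nz card_gt_1[where 'a='a] by (simp add: poly_height_eq)
    qed (use abs_eval_pderiv_T_le[OF True] in auto)
    moreover have "?a ^ 2 \<le> A * ?a" using a_le by (simp add: power2_eq_square mult_right_mono)
    ultimately show ?thesis by (intro exI[of _ ?a]) auto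
  next
    case False
    have "1 \<le> A ^ (2 * n - 1) * sqrt (A * ?a)"
    proof (rule *)
      show "\<not> P dvd pderiv P" by (rule prime_not_dvd_pderiv[OF P(1,2) False])
      show "degree (pderiv P) \<le> degree P" using degree_pderiv_le[of P] by linarith
      have "degree (coeff (pderiv P) i) \<le> hdeg P" for i
      proof -
        have "coeff (pderiv P) i = Polynomial.smult (of_nat (Suc i)) (coeff P (Suc i))"
          unfolding coeff_pderiv by (simp add: of_nat_poly)
        then show ?thesis
          by (metis degree_smult_le degree_coeff_le_hdeg order_trans)
      qed
      then show "poly_height (pderiv P) \<le> poly_height P"
        using False P_nz card_gt_1[where 'a='a] by (simp add: poly_height_eq hdeg_leI)
      show "abs_fls (eval_fls (pderiv P) \<xi>) \<le> sqrt (A * ?a)"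
        using not by (intro real_le_rsqrt) simp
      show "?a \<le> sqrt (A * ?a)"
        using a_le by (intro real_le_rsqrt) (simp add: power2_eq_square mult_right_mono)
    qed (use A in auto)
    then show ?thesis using A by (intro exI[of _ "sqrt (A * ?a)"]) auto
  qed
  then obtain d where d: "d \<ge> 0" "d ^ 2 \<le> A * ?a" "1 \<le> A ^ (2 * n - 1) * d" by blast
  have "n \<ge> 1" using P by simp
  have "1 \<le> (A ^ (2 * n - 1) * d) ^ 2" using d by (simp add: one_le_power)
  also have "\<dots> = A ^ (4 * n - 2) * d ^ 2"
    unfolding power_mult_distrib power_mult[symmetric] by (simp add: diff_mult_distrib)
  also have "\<dots> \<le> A ^ (4 * n - 2) * (A * ?a)" using d A by (intro mult_left_mono) auto
  also have "\<dots> = A ^ (4 * n - 1) * ?a"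
  proof -
    have "4 * n - 1 = Suc (4 * n - 2)" using \<open>n \<ge> 1\<close> by simp
    then show ?thesis by simp
  qed
  finally show False using small by simp
qed

section \<open>Two coprime polynomials that are both small at \<xi>\<close>

lemma prod_power_min_2:
  "2 \<le> a \<Longrightarrow> (\<Prod>s<a. A * \<rho> ^ min s 2) = A ^ a * (\<rho> :: real) ^ (2 * a - 3)"
proof (induction a rule: dec_induct)
  case base
  show ?case by (simp add: numeral_2_eq_2)
next
  case (step n)
  then have "2 * Suc n - 3 = Suc (Suc (2 * n - 3))" "min n 2 = 2" by auto
  with step show ?case by (simp add: power2_eq_square)
qed

lemma prod_powi_max:
  assumes "0 < (\<rho> :: real)"
  shows "4 \<le> N \<Longrightarrow> (\<Prod>c<N. \<rho> powi max (2 - int c) (- 2)) = \<rho> powi (10 - 2 * int N)"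
proof (induction N rule: dec_induct)
  case base
  have "{..<4::nat} = {0, 1, 2, 3}" by auto
  with assms show ?case by (simp flip: power_int_add)
next
  case (step n)
  then have "max (2 - int n) (- 2) = - 2" by auto
  with step assms show ?case by (simp flip: power_int_add)
qed

text \<open>If \<open>P\<close> and \<open>Q\<close> both had at least two roots at distance about \<open>\<rho>\<close> from \<open>\<xi>\<close>, these roots would
  contribute a factor of size \<open>\<rho>\<^sup>4\<close> to the resultant. The weights below extract this factor from
  the Sylvester matrix.\<close>

lemma resultant_inequality_double:
  fixes P Q :: "'a::{field,finite} poly poly"
  assumes P: "prime_elem P" "\<not> P dvd Q" and deg: "2 \<le> degree P" "2 \<le> degree Q"
    and \<rho>: "0 < \<rho>" "\<rho> \<le> 1" and A: "0 \<le> A"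
    and boundP: "\<And>i. abs_fls (coeff (taylor P \<xi>) i) \<le> A * \<rho> ^ (2 - i)"
    and boundQ: "\<And>i. abs_fls (coeff (taylor Q \<xi>) i) \<le> A * \<rho> ^ (2 - i)"
  shows "1 \<le> A ^ (degree P + degree Q) * \<rho> ^ 4"
proof -
  let ?a = "degree Q" and ?b = "degree P"
  \<comment> \<open>The exponents of \<rho> are 0, 1, 2, 2, ... on the rows and 2, 1, 0, -1, -2, -2,
    ... on the columns; in row s and column s + i they add up to at most 2 - i, truncated at 0. For
    degrees a and b the total is (2a - 3) + (2b - 3) + (10 - 2(a + b)) = 4.\<close>
  let ?\<alpha> = "\<lambda>s. A * \<rho> ^ min s 2" and ?\<gamma> = "\<lambda>c. \<rho> powi max (2 - int c) (- 2)"
  have *: "A * \<rho> ^ (2 - i) \<le> ?\<alpha> s * ?\<gamma> (s + i)" for s i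
  proof -
    have "\<rho> ^ (2 - i) = \<rho> powi int (2 - i)" by simp
    also have "\<dots> \<le> \<rho> powi (int (min s 2) + max (2 - int (s + i)) (- 2))"
      using \<rho> by (intro power_int_decreasing) auto
    also have "\<dots> = \<rho> ^ min s 2 * ?\<gamma> (s + i)"
      using \<rho> by (subst power_int_add) auto
    finally show ?thesis using A by (simp add: mult.assoc mult_left_mono)
  qed
  have "1 \<le> (\<Prod>s<?a. ?\<alpha> s) * (\<Prod>s<?b. ?\<alpha> s) * (\<Prod>c<?a + ?b. ?\<gamma> c)"
  proof (rule resultant_inequality[OF P(1) _ P(2), where \<xi> = \<xi>])
    show "abs_fls (coeff (taylor P \<xi>) i) \<le> ?\<alpha> s * ?\<gamma> (s + i)" for s i
      using boundP * by (rule order_trans)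
    show "abs_fls (coeff (taylor Q \<xi>) i) \<le> ?\<alpha> s * ?\<gamma> (s + i)" for s i
      using boundQ * by (rule order_trans)
  qed (use deg A \<rho> in auto)
  also have "\<dots> = A ^ (?b + ?a) * (\<rho> powi int (2 * ?a - 3) * \<rho> powi int (2 * ?b - 3) * \<rho> powi (10 - 2 * int (?a + ?b)))"
    using deg by (simp only: prod_power_min_2 prod_powi_max[OF \<rho>(1)] power_int_of_nat) (simp add: power_add)
  also have "\<rho> powi int (2 * ?a - 3) * \<rho> powi int (2 * ?b - 3) * \<rho> powi (10 - 2 * int (?a + ?b)) = \<rho> powi 4"
    using deg \<rho> by (simp flip: power_int_add add: of_nat_diff)
  finally show ?thesis by simp
qed

lemma abs_lead_coeff_taylor_ge_1:
  assumes "P \<noteq> 0"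
  shows "1 \<le> abs_fls (coeff (taylor P \<xi>) (degree P))"
proof -
  have "lead_coeff (taylor P \<xi>) = fls_of_poly_T (lead_coeff P)"
    unfolding taylor_def by (subst lead_coeff_comp) auto
  then show ?thesis using assms abs_fls_of_poly_T_ge_1[of "lead_coeff P"] by simp
qed

text \<open>The exponent n - 1, instead of 4n - 1 for a single polynomial, lies below Dirichlet's
  exponent n. If the criterion fails for both, the resultant gives 1 \<le> A^(2n) \<rho>^4 =
  (A^(n-1) m)^2, against the smallness of both values.\<close>

lemma newton_of_two_small_values:
  fixes P Q :: "'a::{field,finite} poly poly"
  assumes n: "2 \<le> n" and P: "prime_elem P" "0 < degree P" "degree P \<le> n"
    and Q: "Q \<noteq> 0" "\<not> P dvd Q" "degree Q \<le> n"
    and nz: "eval_fls P \<xi> \<noteq> 0"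
    and A: "\<And>i. abs_fls (coeff (taylor P \<xi>) i) \<le> A" "\<And>i. abs_fls (coeff (taylor Q \<xi>) i) \<le> A" "1 \<le> A"
    and small: "A ^ (n - 1) * abs_fls (eval_fls P \<xi>) < 1" "A ^ (n - 1) * abs_fls (eval_fls Q \<xi>) < 1"
  shows "A * abs_fls (eval_fls P \<xi>) < abs_fls (eval_fls (pderiv P) \<xi>) ^ 2 \<or>
         A * abs_fls (eval_fls Q \<xi>) < abs_fls (eval_fls (pderiv Q) \<xi>) ^ 2"
proof (rule ccontr)
  let ?v = "\<lambda>R. abs_fls (eval_fls R \<xi>)" and ?d = "\<lambda>R. abs_fls (eval_fls (pderiv R) \<xi>)"
  define m where "m = max (?v P) (?v Q)"
  assume neg: "\<not> ?thesis"
  have d: "?d P ^ 2 \<le> A * m" "?d Q ^ 2 \<le> A * m"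
  proof -
    have "A * ?v P \<le> A * m" "A * ?v Q \<le> A * m"
      using A(3) by (auto simp: m_def intro!: mult_left_mono)
    with neg show "?d P ^ 2 \<le> A * m" "?d Q ^ 2 \<le> A * m" by linarith+
  qed
  have m_pos: "m > 0" using nz by (simp add: m_def less_max_iff_disj)
  have Am: "A ^ (n - 1) * m < 1" using small by (auto simp: m_def max_def)
  have "A * m \<le> A ^ (n - 1) * m"
    using A(3) n m_pos power_increasing[of 1 "n - 1" A] by (intro mult_right_mono) auto
  with Am have Am1: "A * m < 1" by simp
  have "1 * m \<le> A * m" using A(3) m_pos by (intro mult_right_mono) auto
  with Am1 have m_less: "m < 1" by simp
  \<comment> \<open>Chosen so that A \<rho>^2 = m bounds both values and A \<rho> = sqrt (A m) both
    derivatives.\<close>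
  define \<rho> where "\<rho> = sqrt (m / A)"
  have \<rho>2: "\<rho> ^ 2 = m / A" and \<rho>_pos: "0 < \<rho>" using m_pos A(3) by (auto simp: \<rho>_def)
  have A\<rho>2: "A * \<rho> ^ 2 = m" using A(3) unfolding \<rho>2 by simp
  have "m / A \<le> 1" using m_less A(3) by simp
  then have \<rho>_le: "\<rho> \<le> 1" by (simp add: \<rho>_def)
  have d_le: "x \<le> A * \<rho>" if "x ^ 2 \<le> A * m" for x
  proof (rule power2_le_imp_le)
    have "(A * \<rho>) ^ 2 = A * m" using A(3) unfolding power_mult_distrib \<rho>2 by (simp add: power2_eq_square)
    with that show "x ^ 2 \<le> (A * \<rho>) ^ 2" by simp
  qed (use A \<rho>_pos in auto)
  have bound: "abs_fls (coeff (taylor R \<xi>) i) \<le> A * \<rho> ^ (2 - i)"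
    if R: "\<And>i. abs_fls (coeff (taylor R \<xi>) i) \<le> A" "?v R \<le> m" "?d R ^ 2 \<le> A * m" for R i
  proof -
    consider "i = 0" | "i = 1" | "i \<ge> 2" by linarith
    then show ?thesis
    proof cases
      case 1
      then show ?thesis using R(2) A\<rho>2 by (simp only: coeff_taylor_0 diff_zero)
    next
      case 2
      then show ?thesis using d_le[OF R(3)] coeff_taylor_1[of R \<xi>] by simp
    qed (use R(1) in simp)
  qed
  \<comment> \<open>In degree 0 or 1 the value or the derivative at \<xi> is the leading
    coefficient, of size at least 1; both are smaller than 1 here.\<close>
  have deg: "2 \<le> degree R" if R: "R \<noteq> 0" "?v R \<le> m" "?d R ^ 2 \<le> A * m" for R
  proof (rule ccontr)
    assume "\<not> 2 \<le> degree R"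
    then consider "degree R = 0" | "degree R = 1" by linarith
    then show False
    proof cases
      case 1
      then show ?thesis using abs_lead_coeff_taylor_ge_1[OF R(1), of \<xi>] R(2) m_less by (simp add: coeff_taylor_0)
    next
      case 2
      then have "1 \<le> ?d R" using abs_lead_coeff_taylor_ge_1[OF R(1), of \<xi>] coeff_taylor_1[of R \<xi>] by simp
      then have "1 \<le> ?d R ^ 2" by (rule one_le_power)
      with R(3) Am1 show ?thesis by linarith
    qed
  qed
  have "1 \<le> A ^ (degree P + degree Q) * \<rho> ^ 4"
    using P Q d A \<rho>_pos \<rho>_le
    by (intro resultant_inequality_double[where \<xi> = \<xi>] bound deg) (auto simp: m_def)
  also have "\<dots> \<le> A ^ (2 * n) * \<rho> ^ 4"
    using A(3) P Q \<rho>_pos by (intro mult_right_mono power_increasing) auto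
  also have "\<rho> ^ 4 = (m / A) ^ 2" unfolding \<rho>2[symmetric] by simp
  also have "A ^ (2 * n) * (m / A) ^ 2 = (A ^ (n - 1) * m) ^ 2"
  proof -
    have "A ^ (2 * n) = (A ^ (n - 1)) ^ 2 * A ^ 2"
    proof -
      have "2 * n = (n - 1) * 2 + 2" using n by simp
      then show ?thesis by (simp only: power_add power_mult)
    qed
    then show ?thesis using A(3) by (simp add: power_mult_distrib power_divide)
  qed
  also have "\<dots> < 1"
    using Am A(3) m_pos by (intro power_less_one_iff[THEN iffD2]) auto
  finally show False by simp
qed

section \<open>Dirichlet's approximation theorem\<close>

lemma abs_eval_fls_le:
  assumes "degree P \<le> n"
  shows "abs_fls (eval_fls P \<xi>) \<le> max 1 (abs_fls \<xi>) ^ n * poly_height P"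
  using abs_coeff_taylor_le[OF assms, of \<xi> 0] by (simp add: coeff_taylor_0)

text \<open>Pigeonhole: Q has (n + 1)(h + 1) free coefficients in the finite field, and one
  condition fewer is imposed on the Laurent coefficients of Q(\<xi>).\<close>

lemma dirichlet:
  fixes \<xi> :: "'a::{field,finite} fls"
  obtains C where "C > 0" "\<And>h. \<exists>Q. Q \<noteq> 0 \<and> degree Q \<le> n \<and> poly_height Q \<le> real CARD('a) ^ h \<and>
     abs_fls (eval_fls Q \<xi>) \<le> C / (real CARD('a) ^ h) ^ n"
proof -
  let ?q = "real CARD('a)"
  have q: "?q > 1" using card_gt_1[where 'a='a] by simp
  obtain m where m: "max 1 (abs_fls \<xi>) \<le> ?q ^ m"
    using real_arch_pow[OF q, of "max 1 (abs_fls \<xi>)"] by (auto intro: less_imp_le)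
  show ?thesis
  proof (rule that)
    show "?q ^ (m * n) > 0" using q by simp
    fix h :: nat
    show "\<exists>Q. Q \<noteq> 0 \<and> degree Q \<le> n \<and> poly_height Q \<le> ?q ^ h \<and>
       abs_fls (eval_fls Q \<xi>) \<le> ?q ^ (m * n) / (?q ^ h) ^ n"
    proof (cases "h * n + n < m * n + 1")
      \<comment> \<open>For such small h the bound is at least 1, and Q = 1 satisfies it.\<close>
      case True
      have "(?q ^ h) ^ n \<le> ?q ^ (m * n)"
        unfolding power_mult[symmetric] using q True by (intro power_increasing) linarith+
      then show ?thesis
        using q poly_height_eq[of "1 :: 'a poly poly"]
        by (intro exI[of _ "1 :: 'a poly poly"]) (auto simp: hdeg_def eval_fls_def divide_simps)
    next
      case False
      define L where "L = h * n + n - m * n"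
      define D where "D = {..n} \<times> {..h} \<rightarrow>\<^sub>E (UNIV :: 'a set)"
      define Q where "Q c = (\<Sum>i\<le>n. monom (\<Sum>j\<le>h. monom (c (i, j)) j) i)" for c :: "nat \<times> nat \<Rightarrow> 'a"
      \<comment> \<open>Here |Q(\<xi>)| \<le> q^w, so coefficients with index below -w vanish
        anyway. The indices from -w to L - 1 give K = w + L = (n + 1)(h + 1) - 1 conditions, and two
        values that agree there differ by at most q^(-L).\<close>
      define w where "w = h + m * n"
      define K where "K = w + L"
      have L: "int L = int (h * n) + int n - int (m * n)" using False by (simp add: L_def)
      define f where "f c = (\<lambda>k\<in>{..<K}. fls_nth (eval_fls (Q c) \<xi>) (int k - int w))" for c
      have coeff_Q: "coeff (coeff (Q c) i) j = (if i \<le> n \<and> j \<le> h then c (i, j) else 0)" for c i j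
        by (simp add: Q_def coeff_sum)
      have deg_Q: "degree (Q c) \<le> n" for c
        by (rule degree_le) (auto intro!: poly_eqI simp: coeff_Q)
      have hdeg_Q: "hdeg (Q c) \<le> h" for c
        by (rule hdeg_leI, rule degree_le) (auto simp: coeff_Q)
      have K: "K < Suc n * Suc h" using False by (simp add: K_def L_def w_def algebra_simps)
      have "card D = CARD('a) ^ (Suc n * Suc h)" by (simp add: D_def card_PiE card_cartesian_product)
      moreover have "f ` D \<subseteq> {..<K} \<rightarrow>\<^sub>E (UNIV :: 'a set)" unfolding f_def by (intro image_subsetI PiE_I) auto
      then have "card (f ` D) \<le> card ({..<K} \<rightarrow>\<^sub>E (UNIV :: 'a set))"
        by (intro card_mono) (auto intro: finite_PiE)
      then have "card (f ` D) \<le> CARD('a) ^ K" by (simp add: card_PiE)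
      moreover have "CARD('a) ^ K < CARD('a) ^ (Suc n * Suc h)"
        using K card_gt_1[where 'a='a] by (intro power_strict_increasing) auto
      ultimately have "\<not> inj_on f D" by (intro pigeonhole) linarith
      then obtain c d where cd: "c \<in> D" "d \<in> D" "f c = f d" "c \<noteq> d" by (auto simp: inj_on_def)
      define R where "R = Q (\<lambda>x. c x - d x)"
      have R: "R = Q c - Q d"
        by (intro poly_eqI) (simp add: R_def coeff_Q)
      obtain i j where ij: "c (i, j) \<noteq> d (i, j)" using cd(4) by (metis ext surj_pair)
      with cd(1,2) have "i \<le> n" "j \<le> h" by (auto simp: D_def PiE_iff extensional_def) metis+
      with ij have "coeff (coeff R i) j \<noteq> 0" by (simp add: R_def coeff_Q)
      then have R_nz: "R \<noteq> 0" by auto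
      have height: "poly_height R \<le> ?q ^ h"
        using R_nz hdeg_Q by (subst poly_height_le_iff) (simp_all add: R_def)
      have "abs_fls (eval_fls R \<xi>) \<le> ?q powi (- int L)"
        unfolding abs_fls_le_powi_iff
      proof (intro allI impI)
        fix i assume i: "i < - (- int L)"
        show "fls_nth (eval_fls R \<xi>) i = 0"
        proof (cases "i < - int w")
          case True
          have "abs_fls (eval_fls R \<xi>) \<le> max 1 (abs_fls \<xi>) ^ n * poly_height R"
            by (rule abs_eval_fls_le) (simp add: R_def deg_Q)
          also have "\<dots> \<le> (?q ^ m) ^ n * ?q ^ h"
            using m height by (intro mult_mono power_mono) auto
          also have "\<dots> = ?q powi int w"
            unfolding power_int_of_nat by (simp add: w_def power_add power_mult mult.commute)
          finally show ?thesis using True unfolding abs_fls_le_powi_iff by blast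
        next
          case False
          define k where "k = nat (i + int w)"
          have k: "k < K" "i = int k - int w" using i False by (auto simp: k_def K_def)
          have "eval_fls R \<xi> = eval_fls (Q c) \<xi> - eval_fls (Q d) \<xi>"
            unfolding R by (simp add: eval_fls_def map_fls_of_poly_T.hom_minus)
          moreover have "f c k = f d k" using cd(3) by simp
          ultimately show ?thesis using k by (simp add: f_def)
        qed
      qed
      also have "?q powi (- int L) \<le> ?q powi (int (m * n) - int (h * n))"
        using q by (subst power_int_le_iff) (auto simp: L)
      also have "\<dots> = ?q ^ (m * n) / (?q ^ h) ^ n"
        using q by (subst power_int_diff) (auto simp only: power_int_of_nat power_mult)
      finally show ?thesis
        using R_nz deg_Q height by (intro exI[of _ R]) (auto simp: R_def)
    qed
  qed
qed

section \<open>The exponents\<close>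

lemma finite_roots:
  assumes "P \<noteq> 0"
  shows "finite {\<alpha>. eval_fls P \<alpha> = 0}"
  using assms poly_roots_finite[of "map_poly fls_of_poly_T P"] by (simp add: eval_fls_def)

lemma algebraic_min_poly:
  assumes "algebraic_fls \<alpha>"
  shows "prime_elem (min_poly_fls \<alpha>)" "min_poly_fls \<alpha> \<noteq> 0" "eval_fls (min_poly_fls \<alpha>) \<alpha> = 0"
proof -
  obtain P where P: "P \<noteq> 0" "eval_fls P \<alpha> = 0" using assms by (auto simp: algebraic_fls_def)
  show "prime_elem (min_poly_fls \<alpha>)" "eval_fls (min_poly_fls \<alpha>) \<alpha> = 0"
    by (rule min_poly_fls_props[OF P])+
  then show "min_poly_fls \<alpha> \<noteq> 0" by (intro prime_elem_not_zeroI)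
qed

lemma finite_bounded_alg_height:
  "finite {\<alpha> :: 'a::{field,finite} fls. algebraic_fls \<alpha> \<and> alg_degree \<alpha> \<le> n \<and> alg_height \<alpha> \<le> B}"
proof (rule finite_subset)
  let ?F = "{P :: 'a poly poly. degree P \<le> n \<and> poly_height P \<le> B} - {0}"
  show "{\<alpha>. algebraic_fls \<alpha> \<and> alg_degree \<alpha> \<le> n \<and> alg_height \<alpha> \<le> B} \<subseteq> (\<Union>P\<in>?F. {\<alpha>. eval_fls P \<alpha> = 0})"
    using algebraic_min_poly by (fastforce simp: alg_degree_def alg_height_def)
  show "finite (\<Union>P\<in>?F. {\<alpha>. eval_fls P \<alpha> = 0})"
    using finite_bounded_height finite_roots by (intro finite_UN_I) auto
qed

text \<open>Asking only for every w' < w leaves a positive power of the height to absorb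
  constants.\<close>

lemma w_exp_ge:
  assumes "\<And>w'. w' < w \<Longrightarrow> infinite {P. degree P \<le> n \<and> 0 < abs_fls (eval_fls P \<xi>) \<and>
     abs_fls (eval_fls P \<xi>) < poly_height P powr (- w')}"
  shows "ereal w \<le> w_exp n \<xi>"
proof (rule dense_le)
  fix x :: ereal assume x: "x < ereal w"
  then obtain w' where w': "x < ereal w'" "ereal w' < ereal w" using ereal_dense2 by blast
  then have "ereal w' \<le> w_exp n \<xi>"
    unfolding w_exp_def by (intro Sup_upper) (use assms[of w'] in auto)
  with w' show "x \<le> w_exp n \<xi>" by auto
qed

lemma eventually_powr_less:
  assumes "0 < d" "0 < (e :: real)"
  obtains B where "1 \<le> B" "\<And>H. B < H \<Longrightarrow> H powr (- d) < e"
proof (rule that)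
  let ?B = "max 1 ((1 / e) powr (1 / d))"
  show "1 \<le> ?B" by simp
  fix H assume H: "?B < H"
  then have "(1 / e) powr (1 / d) < H" "0 < H" by auto
  then have "((1 / e) powr (1 / d)) powr d < H powr d" using assms by (intro powr_less_mono2) auto
  then have "1 / e < H powr d" using assms by (simp add: powr_powr)
  with assms \<open>0 < H\<close> show "H powr (- d) < e" by (simp add: powr_minus field_simps)
qed

text \<open>One solution for each tolerance replaces infinitely many solutions. The quantity
  |P(\<xi>)| H(P)^w is multiplicative, so its smallness can be traced to a prime factor.\<close>

definition small_values :: "nat \<Rightarrow> 'a::{field,finite} fls \<Rightarrow> real \<Rightarrow> bool" where
  "small_values n \<xi> w \<longleftrightarrow> (\<forall>e>0. \<exists>P. degree P \<le> n \<and> eval_fls P \<xi> \<noteq> 0 \<and>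
     abs_fls (eval_fls P \<xi>) * poly_height P powr w < e)"

lemma poly_nonzero_of_eval: "eval_fls P \<xi> \<noteq> 0 \<Longrightarrow> P \<noteq> 0"
  by auto

lemma w_exp_less_imp:
  fixes \<xi> :: "'a::{field,finite} fls"
  assumes "ereal w < w_exp n \<xi>"
  obtains w' where "w < w'" "infinite {P. degree P \<le> n \<and> 0 < abs_fls (eval_fls P \<xi>) \<and>
     abs_fls (eval_fls P \<xi>) < poly_height P powr (- w')}"
  using assms unfolding w_exp_def less_Sup_iff by auto

lemma infinite_unbounded_height:
  fixes S :: "'a::{field,finite} poly poly set"
  assumes "infinite S" "\<And>P. P \<in> S \<Longrightarrow> degree P \<le> n"
  obtains P where "P \<in> S" "B < poly_height P"
proof -
  have "\<not> S \<subseteq> {P. degree P \<le> n \<and> poly_height P \<le> B}"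
    using assms(1) finite_subset[OF _ finite_bounded_height[of n B]] by blast
  with assms(2) obtain P where "P \<in> S" "\<not> poly_height P \<le> B" by blast
  then show ?thesis by (intro that) auto
qed

lemma small_values_of_w_exp:
  assumes "ereal w < w_exp n \<xi>"
  shows "small_values n \<xi> w"
  unfolding small_values_def
proof (intro allI impI)
  fix e :: real assume e: "e > 0"
  obtain w' where w': "w < w'" "infinite {P. degree P \<le> n \<and> 0 < abs_fls (eval_fls P \<xi>) \<and>
     abs_fls (eval_fls P \<xi>) < poly_height P powr (- w')}" (is "infinite ?S")
    using w_exp_less_imp[OF assms] .
  obtain B where B: "1 \<le> B" "\<And>H. B < H \<Longrightarrow> H powr (- (w' - w)) < e"
    using eventually_powr_less[of "w' - w" e] w'(1) e by auto
  obtain P where P: "P \<in> ?S" "B < poly_height P"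
    by (rule infinite_unbounded_height[OF w'(2), of n B]) auto
  have "abs_fls (eval_fls P \<xi>) * poly_height P powr w \<le> poly_height P powr (- w') * poly_height P powr w"
    using P by (intro mult_right_mono) auto
  also have "\<dots> = poly_height P powr (- (w' - w))" by (simp flip: powr_add)
  also have "\<dots> < e" by (rule B(2)[OF P(2)])
  finally show "\<exists>P. degree P \<le> n \<and> eval_fls P \<xi> \<noteq> 0 \<and> abs_fls (eval_fls P \<xi>) * poly_height P powr w < e"
    using P by auto
qed

lemma small_values_dirichlet:
  fixes \<xi> :: "'a::{field,finite} fls"
  assumes \<xi>: "\<not> algebraic_fls \<xi>" and w: "0 \<le> w" "w < real n"
  shows "small_values n \<xi> w"
  unfolding small_values_def
proof (intro allI impI)
  fix e :: real assume e: "e > 0"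
  let ?q = "real CARD('a)"
  have q: "?q > 1" using card_gt_1[where 'a='a] by simp
  obtain C where C: "C > 0" "\<And>h. \<exists>Q. Q \<noteq> 0 \<and> degree Q \<le> n \<and> poly_height Q \<le> ?q ^ h \<and>
     abs_fls (eval_fls Q \<xi>) \<le> C / (?q ^ h) ^ n"
    using dirichlet[of n \<xi>] by metis
  obtain B where B: "1 \<le> B" "\<And>H. B < H \<Longrightarrow> H powr (- (real n - w)) < e / C"
    using eventually_powr_less[of "real n - w" "e / C"] w C e by auto
  obtain h where h: "B < ?q ^ h" using real_arch_pow[OF q] by blast
  obtain Q where Q: "Q \<noteq> 0" "degree Q \<le> n" "poly_height Q \<le> ?q ^ h"
    "abs_fls (eval_fls Q \<xi>) \<le> C / (?q ^ h) ^ n" using C(2) by blast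
  have "abs_fls (eval_fls Q \<xi>) * poly_height Q powr w \<le> (C / (?q ^ h) ^ n) * (?q ^ h) powr w"
    using Q w C q by (intro mult_mono powr_mono2) auto
  also have "\<dots> = C * (?q ^ h) powr (- (real n - w))"
    using q by (simp add: powr_diff powr_realpow divide_simps)
  also have "\<dots> < C * (e / C)" using B(2)[OF h] C by (intro mult_strict_left_mono) auto
  finally have "abs_fls (eval_fls Q \<xi>) * poly_height Q powr w < e" using C by simp
  moreover have "eval_fls Q \<xi> \<noteq> 0" using \<xi> Q by (auto simp: algebraic_fls_def)
  ultimately show "\<exists>P. degree P \<le> n \<and> eval_fls P \<xi> \<noteq> 0 \<and> abs_fls (eval_fls P \<xi>) * poly_height P powr w < e"
    using Q by blast
qed

text \<open>\<phi>(P) = |P(\<xi>)| H(P)^w is multiplicative by Gauss's lemma and at least 1 on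
  nonzero constants. If \<phi>(P) < d^(deg P), some prime factor F has \<phi>(F) < d^(deg F); so F
  is not constant, and \<phi>(F) < d because d < 1.\<close>

lemma small_values_prime:
  fixes \<xi> :: "'a::{field,finite} fls"
  assumes small: "small_values n \<xi> w" and w: "0 \<le> w" and e: "0 < e"
  obtains P where "prime_elem P" "0 < degree P" "degree P \<le> n" "eval_fls P \<xi> \<noteq> 0"
    "abs_fls (eval_fls P \<xi>) * poly_height P powr w < e"
proof -
  define \<phi> where "\<phi> P = abs_fls (eval_fls P \<xi>) * poly_height P powr w" for P
  have \<phi>_mult: "\<phi> (P * Q) = \<phi> P * \<phi> Q" for P Q
    by (simp add: \<phi>_def eval_fls_mult abs_fls_mult poly_height_mult powr_mult)
  have \<phi>_nonneg: "0 \<le> \<phi> P" for P by (simp add: \<phi>_def)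
  have \<phi>_const: "1 \<le> \<phi> P" if "degree P = 0" "P \<noteq> 0" for P
  proof -
    obtain a where a: "P = [:a:]" using \<open>degree P = 0\<close> by (rule degree_eq_zeroE)
    with that have "1 \<le> abs_fls (eval_fls P \<xi>)"
      using abs_fls_of_poly_T_ge_1[of a] by (simp add: eval_fls_const)
    moreover have "1 \<le> poly_height P powr w"
      using poly_height_ge_1[OF that(2)] w by (rule ge_one_powr_ge_zero)
    ultimately show ?thesis unfolding \<phi>_def using mult_mono[of 1 _ 1] by fastforce
  qed
  define d where "d = min e (1 / 2)"
  have d: "0 < d" "d < 1" "d \<le> e" using e by (auto simp: d_def)
  have *: "\<exists>F. prime_elem F \<and> degree F \<le> degree P \<and> eval_fls F \<xi> \<noteq> 0 \<and> \<phi> F < d ^ degree F"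
    if "P \<noteq> 0" "eval_fls P \<xi> \<noteq> 0" "\<phi> P < d ^ degree P" for P
    using that
  proof (induction P rule: ufd_prime_induct)
    case (unit u)
    then have "degree u = 0" "u \<noteq> 0" by (auto simp: poly_dvd_1)
    with \<phi>_const[of u] unit(3) show ?case by simp
  next
    case (prime p x)
    have nz: "p \<noteq> 0" using prime(1) by (rule prime_elem_not_zeroI)
    have eval: "eval_fls p \<xi> \<noteq> 0" "eval_fls x \<xi> \<noteq> 0" using prime(4) by (auto simp: eval_fls_mult)
    have "\<phi> p * \<phi> x < d ^ degree p * d ^ degree x"
      using prime(5) nz prime(2) by (simp add: \<phi>_mult degree_mult_eq power_add)
    then consider "\<phi> p < d ^ degree p" | "\<phi> x < d ^ degree x"
      using mult_mono[of "d ^ degree p" "\<phi> p" "d ^ degree x" "\<phi> x"] \<phi>_nonneg[of p] d by fastforce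
    then show ?case
    proof cases
      case 1
      have "degree p \<le> degree (p * x)" using nz prime(2) by (simp add: degree_mult_eq)
      with 1 prime(1) eval(1) show ?thesis by metis
    next
      case 2
      have "degree x \<le> degree (p * x)" using nz prime(2) by (simp add: degree_mult_eq)
      with prime(3)[OF eval(2) 2] show ?thesis by (metis order_trans)
    qed
  qed
  obtain P where P: "degree P \<le> n" "eval_fls P \<xi> \<noteq> 0" "\<phi> P < d ^ n"
    using small d(1) unfolding small_values_def \<phi>_def by (meson zero_less_power)
  have "\<phi> P < d ^ degree P"
    using P(3) power_decreasing[OF P(1), of d] d by linarith
  then obtain F where F: "prime_elem F" "degree F \<le> degree P" "eval_fls F \<xi> \<noteq> 0" "\<phi> F < d ^ degree F"
    using *[OF poly_nonzero_of_eval[OF P(2)] P(2)] by metis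
  have deg: "0 < degree F"
  proof (rule ccontr)
    assume "\<not> 0 < degree F"
    with \<phi>_const[of F] poly_nonzero_of_eval[OF F(3)] F(4) show False by simp
  qed
  have "\<phi> F < e"
    using F(4) power_decreasing[of 1 "degree F" d] d deg by simp
  with F P deg that show ?thesis by (simp add: \<phi>_def)
qed

text \<open>Approximations within every e > 0 are automatically infinitely many. Passing from P to
  the minimal polynomial of \<alpha> does not raise the height, which is harmless because the
  exponent - w - 1 is not positive.\<close>

lemma w_star_exp_ge:
  fixes \<xi> :: "'a::{field,finite} fls"
  assumes w: "- 1 \<le> w"
    and approx: "\<And>e. 0 < e \<Longrightarrow> \<exists>P \<alpha>. P \<noteq> 0 \<and> degree P \<le> n \<and> eval_fls P \<alpha> = 0 \<and> \<alpha> \<noteq> \<xi> \<and>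
      abs_fls (\<xi> - \<alpha>) < e \<and> abs_fls (\<xi> - \<alpha>) < poly_height P powr (- w - 1)"
  shows "ereal w \<le> w_star_exp n \<xi>"
proof -
  let ?S = "{\<alpha>. algebraic_fls \<alpha> \<and> alg_degree \<alpha> \<le> n \<and>
       0 < abs_fls (\<xi> - \<alpha>) \<and> abs_fls (\<xi> - \<alpha>) < alg_height \<alpha> powr (- w - 1)}"
  have "infinite ?S"
  proof
    assume fin: "finite ?S"
    define e where "e = Min (insert 1 ((\<lambda>\<alpha>. abs_fls (\<xi> - \<alpha>)) ` ?S))"
    have "0 < e" using fin by (auto simp: e_def)
    then obtain P \<alpha> where P: "P \<noteq> 0" "degree P \<le> n" "eval_fls P \<alpha> = 0" "\<alpha> \<noteq> \<xi>"
      "abs_fls (\<xi> - \<alpha>) < e" "abs_fls (\<xi> - \<alpha>) < poly_height P powr (- w - 1)" using approx by blast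
    note h = alg_degree_height_le[OF P(1,3)]
    have "poly_height P powr (- w - 1) \<le> alg_height \<alpha> powr (- w - 1)"
      using h w by (intro powr_mono2') auto
    then have "\<alpha> \<in> ?S" using P h by (auto simp: algebraic_fls_def)
    then have "e \<le> abs_fls (\<xi> - \<alpha>)" unfolding e_def using fin by (intro Min_le) auto
    with P(5) show False by simp
  qed
  then show ?thesis unfolding w_star_exp_def by (intro Sup_upper) auto
qed

lemma w_star_exp_ge_of_large_w:
  fixes \<xi> :: "'a::{field,finite} fls"
  assumes n: "1 \<le> n" and w: "4 * real n \<le> w" and small: "small_values n \<xi> w"
  shows "ereal ((w - 1) / 2) \<le> w_star_exp n \<xi>"
proof (rule w_star_exp_ge)
  show "- 1 \<le> (w - 1) / 2" using w by simp
  fix e :: real assume e: "0 < e"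
  let ?C = "max 1 (abs_fls \<xi>) ^ n"
  have C: "1 \<le> ?C" by simp
  \<comment> \<open>The entry e^2 brings \<alpha> within e of \<xi>; the last entry cancels the
    power of C in A^(4n - 1) |P(\<xi>)| < 1, where A = C H.\<close>
  define d where "d = min (min 1 (e ^ 2)) (1 / ?C ^ (4 * n - 1))"
  have d: "0 < d" "d \<le> 1" "d \<le> e ^ 2" "d * ?C ^ (4 * n - 1) \<le> 1"
  proof -
    show "0 < d" "d \<le> 1" "d \<le> e ^ 2" using e C by (auto simp: d_def)
    have "d * ?C ^ (4 * n - 1) \<le> 1 / ?C ^ (4 * n - 1) * ?C ^ (4 * n - 1)"
      by (intro mult_right_mono) (auto simp: d_def)
    also have "\<dots> = 1" using C by simp
    finally show "d * ?C ^ (4 * n - 1) \<le> 1" .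
  qed
  obtain P where P: "prime_elem P" "0 < degree P" "degree P \<le> n" "eval_fls P \<xi> \<noteq> 0"
    "abs_fls (eval_fls P \<xi>) * poly_height P powr w < d"
    using small_values_prime[OF small _ d(1)] w by (metis order_trans mult_nonneg_nonneg of_nat_0_le_iff zero_le_numeral)
  let ?a = "abs_fls (eval_fls P \<xi>)" and ?H = "poly_height P"
  let ?A = "?C * ?H"
  have H: "1 \<le> ?H" using poly_nonzero_of_eval[OF P(4)] by (rule poly_height_ge_1)
  have A: "1 \<le> ?A" "?H \<le> ?A"
    using mult_mono[OF C H] C H mult_right_mono[OF C, of ?H] by simp_all
  have a_less: "?a < d * ?H powr (- w)" using P(5) H by (simp add: powr_minus field_simps)
  have newton: "?A * ?a < abs_fls (eval_fls (pderiv P) \<xi>) ^ 2"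
  proof (rule newton_of_small_value[OF P(1-3)])
    have "?A ^ (4 * n - 1) * ?a = ?C ^ (4 * n - 1) * (?H powr real (4 * n - 1) * ?a)"
      using H by (simp add: power_mult_distrib powr_realpow)
    also have "\<dots> \<le> ?C ^ (4 * n - 1) * (?H powr w * ?a)"
      using C H w n by (intro mult_left_mono mult_right_mono powr_mono) auto
    also have "\<dots> < ?C ^ (4 * n - 1) * d"
      using P(5) C by (intro mult_strict_left_mono) (auto simp: mult.commute)
    also have "\<dots> \<le> 1" using d(4) by (simp add: mult.commute)
    finally show "?A ^ (4 * n - 1) * ?a < 1" .
  qed (use A in auto)
  obtain \<alpha> where \<alpha>: "eval_fls P \<alpha> = 0" "\<alpha> \<noteq> \<xi>" "abs_fls (\<xi> - \<alpha>) ^ 2 \<le> ?a / ?A"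
    using root_near[OF abs_coeff_taylor_le[OF P(3)] A(1) P(4) newton] by metis
  have "?a / ?A \<le> ?a / ?H" using A H by (intro divide_left_mono) auto
  also have "\<dots> < d * ?H powr (- w) / ?H" using a_less H by (intro divide_strict_right_mono) auto
  also have "\<dots> = d * ?H powr (- (w + 1))"
    using H by (simp add: powr_diff powr_minus powr_add field_simps)
  finally have near: "abs_fls (\<xi> - \<alpha>) ^ 2 < d * ?H powr (- (w + 1))" using \<alpha>(3) by simp
  have H_le: "?H powr (- (w + 1)) \<le> 1" using powr_mono[of "- (w + 1)" 0 ?H] H w by simp
  have "abs_fls (\<xi> - \<alpha>) ^ 2 < e ^ 2"
    using near mult_mono[OF d(3) H_le] e by simp
  then have "abs_fls (\<xi> - \<alpha>) < e" using e by (simp add: power2_less_imp_less)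
  moreover have "abs_fls (\<xi> - \<alpha>) ^ 2 < (?H powr (- ((w - 1) / 2) - 1)) ^ 2"
  proof -
    have "(- ((w - 1) / 2) - 1) + (- ((w - 1) / 2) - 1) = - (w + 1)" by (simp add: field_simps)
    then have "(?H powr (- ((w - 1) / 2) - 1)) ^ 2 = ?H powr (- (w + 1))"
      by (simp only: power2_eq_square flip: powr_add)
    moreover have "d * ?H powr (- (w + 1)) \<le> 1 * ?H powr (- (w + 1))"
      using d by (intro mult_right_mono) auto
    ultimately show ?thesis using near by linarith
  qed
  then have "abs_fls (\<xi> - \<alpha>) < ?H powr (- ((w - 1) / 2) - 1)" by (rule power2_less_imp_less) simp
  ultimately show "\<exists>P \<alpha>. P \<noteq> 0 \<and> degree P \<le> n \<and> eval_fls P \<alpha> = 0 \<and> \<alpha> \<noteq> \<xi> \<and>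
      abs_fls (\<xi> - \<alpha>) < e \<and> abs_fls (\<xi> - \<alpha>) < poly_height P powr (- ((w - 1) / 2) - 1)"
    using P(3) \<alpha> poly_nonzero_of_eval[OF P(4)] by blast
qed

lemma values_bounded_below:
  fixes \<xi> :: "'a::{field,finite} fls"
  shows "\<exists>m>0. \<forall>P. degree P \<le> n \<and> poly_height P \<le> B \<and> eval_fls P \<xi> \<noteq> 0 \<longrightarrow>
    m \<le> abs_fls (eval_fls P \<xi>)"
proof -
  let ?S = "{P. degree P \<le> n \<and> poly_height P \<le> B} \<inter> {P. eval_fls P \<xi> \<noteq> 0}"
  let ?T = "insert 1 ((\<lambda>P. abs_fls (eval_fls P \<xi>)) ` ?S)"
  have fin: "finite ?T" using finite_bounded_height by auto
  show ?thesis
  proof (intro exI[of _ "Min ?T"] conjI allI impI)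
    show "0 < Min ?T" using fin by auto
    fix P assume "degree P \<le> n \<and> poly_height P \<le> B \<and> eval_fls P \<xi> \<noteq> 0"
    then show "Min ?T \<le> abs_fls (eval_fls P \<xi>)" by (intro Min_le[OF fin]) auto
  qed
qed

text \<open>A prime \<open>P\<close> with a small value at \<open>\<xi>\<close> is paired with a polynomial \<open>Q\<close> of smaller height from
  Dirichlet's theorem. By Gauss's lemma \<open>P\<close> does not divide \<open>Q\<close>, so Newton's criterion holds for one
  of the two.\<close>

lemma w_star_exp_ge_of_transcendental:
  fixes \<xi> :: "'a::{field,finite} fls"
  assumes \<xi>: "\<not> algebraic_fls \<xi>" and n: "2 \<le> n"
  shows "ereal (real n / 2 - 1) \<le> w_star_exp n \<xi>"
proof (rule w_star_exp_ge)
  show "- 1 \<le> real n / 2 - 1" by simp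
  fix e :: real assume e: "0 < e"
  let ?q = "real CARD('a)"
  have q: "?q > 1" using card_gt_1[where 'a='a] by simp
  let ?C = "max 1 (abs_fls \<xi>) ^ n"
  have C: "1 \<le> ?C" by simp
  \<comment> \<open>Halfway between n - 1, which the criterion for two polynomials requires, and n,
    which Dirichlet's theorem provides: half a power of H remains on either side.\<close>
  define w where "w = real n - 1 / 2"
  have w: "0 \<le> w" "w < real n" "real (n - 1) \<le> w" using n by (auto simp: w_def)
  define d where "d = min (min 1 (e ^ 2)) (1 / ?C ^ (n - 1))"
  have d: "0 < d" "d \<le> 1" "d \<le> e ^ 2" "d * ?C ^ (n - 1) \<le> 1"
  proof -
    show "0 < d" "d \<le> 1" "d \<le> e ^ 2" using e C by (auto simp: d_def)
    have "d * ?C ^ (n - 1) \<le> 1 / ?C ^ (n - 1) * ?C ^ (n - 1)"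
      by (intro mult_right_mono) (auto simp: d_def)
    also have "\<dots> = 1" using C by simp
    finally show "d * ?C ^ (n - 1) \<le> 1" .
  qed
  obtain D where D: "D > 0" "\<And>h. \<exists>Q. Q \<noteq> 0 \<and> degree Q \<le> n \<and> poly_height Q \<le> ?q ^ h \<and>
     abs_fls (eval_fls Q \<xi>) \<le> D / (?q ^ h) ^ n"
    using dirichlet[of n \<xi>] by metis
  obtain B where B: "1 \<le> B" "\<And>H. B < H \<Longrightarrow> H powr (- (1 / 2)) < d / (D * ?q ^ n)"
    using eventually_powr_less[of "1 / 2" "d / (D * ?q ^ n)"] d D q by auto
  \<comment> \<open>Bounds all nonzero values at height at most B from below, so a P with |P(\<xi>)|
    H(P)^w < m has height above B.\<close>
  obtain m where m: "0 < m" "\<forall>P. degree P \<le> n \<and> poly_height P \<le> B \<and> eval_fls P \<xi> \<noteq> 0 \<longrightarrow>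
      m \<le> abs_fls (eval_fls P \<xi>)"
    using values_bounded_below[of n B \<xi>] by blast
  have dm: "0 < min d m" using d m by simp
  obtain P where P: "prime_elem P" "0 < degree P" "degree P \<le> n" "eval_fls P \<xi> \<noteq> 0"
    "abs_fls (eval_fls P \<xi>) * poly_height P powr w < min d m"
    using small_values_prime[OF small_values_dirichlet[OF \<xi> w(1,2)] w(1) dm] .
  let ?H = "poly_height P"
  have P_nz: "P \<noteq> 0" by (rule poly_nonzero_of_eval[OF P(4)])
  have H: "1 \<le> ?H" by (rule poly_height_ge_1[OF P_nz])
  have BH: "B < ?H"
  proof (rule ccontr)
    assume "\<not> B < ?H"
    then have "m \<le> abs_fls (eval_fls P \<xi>)" using m(2) P by simp
    also have "\<dots> * 1 \<le> \<dots> * ?H powr w"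
      using H w by (intro mult_left_mono ge_one_powr_ge_zero) auto
    finally show False using P(5) by simp
  qed
  have "hdeg P \<noteq> 0"
  proof
    assume "hdeg P = 0"
    then have "?H = 1" by (simp add: poly_height_eq[OF P_nz])
    with BH B(1) show False by simp
  qed
  \<comment> \<open>Heights are powers of q, so q^h is the largest height below H(P). The lost
    factor q costs q^n in Dirichlet's bound.\<close>
  then obtain h where h: "hdeg P = Suc h" by (metis not0_implies_Suc)
  have H_eq: "?H = ?q * ?q ^ h" by (simp add: poly_height_eq[OF P_nz] h)
  obtain Q where Q: "Q \<noteq> 0" "degree Q \<le> n" "poly_height Q \<le> ?q ^ h"
    "abs_fls (eval_fls Q \<xi>) \<le> D / (?q ^ h) ^ n" using D(2) by blast
  have HQ: "poly_height Q < ?H" using Q(3) q H_eq by (smt (verit) mult_less_cancel_right1 zero_less_power)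
  have not_dvd: "\<not> P dvd Q" using poly_height_dvd_le[OF _ Q(1)] HQ by (meson not_le)
  have valP: "abs_fls (eval_fls P \<xi>) \<le> d * ?H powr (- w)"
    using P(5) H by (simp add: powr_minus field_simps)
  have valQ: "abs_fls (eval_fls Q \<xi>) \<le> d * ?H powr (- w)"
  proof -
    have "D / (?q ^ h) ^ n = D * ?q ^ n / ?H ^ n" using q by (simp add: H_eq power_mult_distrib)
    also have "\<dots> = D * ?q ^ n * ?H powr (- (1 / 2)) * ?H powr (- w)"
      using H by (simp add: w_def powr_diff powr_minus powr_realpow field_simps flip: powr_add)
    also have "\<dots> \<le> D * ?q ^ n * (d / (D * ?q ^ n)) * ?H powr (- w)"
      using B(2)[OF BH] D q by (intro mult_right_mono mult_left_mono) auto
    also have "\<dots> = d * ?H powr (- w)" using D q by simp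
    finally show ?thesis using Q(4) by simp
  qed
  let ?A = "?C * ?H"
  have A: "1 \<le> ?A" "?H \<le> ?A"
    using mult_mono[OF C H] C H mult_right_mono[OF C, of ?H] by simp_all
  have small: "?A ^ (n - 1) * x < 1" if "x \<le> d * ?H powr (- w)" "0 \<le> x" for x
  proof -
    have "?A ^ (n - 1) * x \<le> ?A ^ (n - 1) * (d * ?H powr (- w))"
      using that A by (intro mult_left_mono) auto
    also have "\<dots> = (d * ?C ^ (n - 1)) * (?H powr real (n - 1) * ?H powr (- w))"
      using H by (simp add: power_mult_distrib powr_realpow mult_ac)
    also have "\<dots> \<le> 1 * (?H powr real (n - 1) * ?H powr (- w))"
      using d(4) by (intro mult_right_mono) auto
    also have "\<dots> = ?H powr (- (1 / 2))"
      using n by (simp add: w_def of_nat_diff flip: powr_add)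
    also have "\<dots> < 1"
      using powr_less_mono[of "- (1 / 2)" 0 ?H] BH B(1) by simp
    finally show ?thesis .
  qed
  \<comment> \<open>Either P or Q may supply the root. The estimates are in terms of H = H(P), and
    H(R) \<le> H turns the final one into a bound in H(R).\<close>
  have result: "\<exists>P \<alpha>. P \<noteq> 0 \<and> degree P \<le> n \<and> eval_fls P \<alpha> = 0 \<and> \<alpha> \<noteq> \<xi> \<and>
      abs_fls (\<xi> - \<alpha>) < e \<and> abs_fls (\<xi> - \<alpha>) < poly_height P powr (- (real n / 2 - 1) - 1)"
    if R: "R \<noteq> 0" "degree R \<le> n" "poly_height R \<le> ?H" "eval_fls R \<xi> \<noteq> 0"
      "abs_fls (eval_fls R \<xi>) \<le> d * ?H powr (- w)"
      "?A * abs_fls (eval_fls R \<xi>) < abs_fls (eval_fls (pderiv R) \<xi>) ^ 2" for R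
  proof -
    have bound: "abs_fls (coeff (taylor R \<xi>) i) \<le> ?A" for i
      by (rule order_trans[OF abs_coeff_taylor_le[OF R(2)] mult_left_mono[OF R(3)]]) simp
    obtain \<alpha> where \<alpha>: "eval_fls R \<alpha> = 0" "\<alpha> \<noteq> \<xi>"
        "abs_fls (\<xi> - \<alpha>) ^ 2 \<le> abs_fls (eval_fls R \<xi>) / ?A"
      using root_near[OF bound A(1) R(4,6)] by metis
    have "abs_fls (eval_fls R \<xi>) / ?A \<le> abs_fls (eval_fls R \<xi>) / ?H"
      using A H by (intro divide_left_mono) auto
    also have "\<dots> \<le> d * ?H powr (- w) / ?H" using R(5) H by (intro divide_right_mono) auto
    also have "\<dots> = d * (?H powr (- (w + 1)))"
      using H by (simp add: powr_diff powr_minus powr_add field_simps)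
    also have "\<dots> < d * ?H powr (- real n)"
      using d(1) BH B(1) by (intro mult_strict_left_mono powr_less_mono) (auto simp: w_def)
    finally have near: "abs_fls (\<xi> - \<alpha>) ^ 2 < d * ?H powr (- real n)" using \<alpha>(3) by simp
    have H_le: "?H powr (- real n) \<le> 1" using powr_mono[of "- real n" 0 ?H] H by simp
    have "abs_fls (\<xi> - \<alpha>) ^ 2 < e ^ 2"
      using near mult_mono[OF d(3) H_le] e by simp
    then have near_e: "abs_fls (\<xi> - \<alpha>) < e" using e by (simp add: power2_less_imp_less)
    have "abs_fls (\<xi> - \<alpha>) ^ 2 < (?H powr (- (real n / 2 - 1) - 1)) ^ 2"
    proof -
      have "(- (real n / 2 - 1) - 1) + (- (real n / 2 - 1) - 1) = - real n" by (simp add: field_simps)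
      then have "(?H powr (- (real n / 2 - 1) - 1)) ^ 2 = ?H powr (- real n)"
        by (simp only: power2_eq_square flip: powr_add)
      moreover have "d * ?H powr (- real n) \<le> 1 * ?H powr (- real n)"
        using d by (intro mult_right_mono) auto
      ultimately show ?thesis using near by linarith
    qed
    then have "abs_fls (\<xi> - \<alpha>) < ?H powr (- (real n / 2 - 1) - 1)" by (rule power2_less_imp_less) simp
    also have "\<dots> \<le> poly_height R powr (- (real n / 2 - 1) - 1)"
      using R(3) poly_height_ge_1[OF R(1)] by (intro powr_mono2') auto
    finally show ?thesis using R(1,2) \<alpha> near_e by blast
  qed
  have boundQ: "abs_fls (coeff (taylor Q \<xi>) i) \<le> ?A" for i
    by (rule order_trans[OF abs_coeff_taylor_le[OF Q(2)] mult_left_mono[OF less_imp_le[OF HQ]]]) simp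
  have Q_eval: "eval_fls Q \<xi> \<noteq> 0" using \<xi> Q(1) by (auto simp: algebraic_fls_def)
  have "?A * abs_fls (eval_fls P \<xi>) < abs_fls (eval_fls (pderiv P) \<xi>) ^ 2 \<or>
        ?A * abs_fls (eval_fls Q \<xi>) < abs_fls (eval_fls (pderiv Q) \<xi>) ^ 2"
    by (rule newton_of_two_small_values[OF n P(1-3) Q(1) not_dvd Q(2) P(4)
          abs_coeff_taylor_le[OF P(3)] boundQ A(1) small[OF valP] small[OF valQ]]) simp_all
  then show "\<exists>P \<alpha>. P \<noteq> 0 \<and> degree P \<le> n \<and> eval_fls P \<alpha> = 0 \<and> \<alpha> \<noteq> \<xi> \<and>
      abs_fls (\<xi> - \<alpha>) < e \<and> abs_fls (\<xi> - \<alpha>) < poly_height P powr (- (real n / 2 - 1) - 1)"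
    using result[OF P_nz P(3) order_refl P(4) valP] result[OF Q(1,2) less_imp_le[OF HQ] Q_eval valQ]
    by argo
qed

text \<open>The supremum ranges over negative w too, so a lower bound needs witnesses: the constants
  P = T^(k+1), with |P(\<xi>)| = H(P) < H(P)^2.\<close>

lemma w_exp_ge_m2: "ereal (- 2) \<le> w_exp n (\<xi> :: 'a::{field,finite} fls)"
proof -
  let ?S = "{P :: 'a poly poly. degree P \<le> n \<and> 0 < abs_fls (eval_fls P \<xi>) \<and>
     abs_fls (eval_fls P \<xi>) < poly_height P powr (- (- 2))}"
  let ?P = "\<lambda>k. [:monom 1 (Suc k):] :: 'a poly poly"
  have q: "real CARD('a) > 1" using card_gt_1[where 'a='a] by simp
  have "?P k \<in> ?S" for k
  proof -
    have v: "abs_fls (eval_fls (?P k) \<xi>) = real CARD('a) ^ Suc k"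
      by (simp add: eval_fls_const abs_fls_of_poly_T degree_monom_eq)
    have H: "poly_height (?P k) = real CARD('a) ^ Suc k"
      by (simp add: poly_height_eq hdeg_def degree_monom_eq)
    have nz: "eval_fls (?P k) \<xi> \<noteq> 0" by (simp add: eval_fls_const)
    have "1 < real CARD('a) ^ Suc k" using q by (rule one_less_power) simp
    then have "real CARD('a) ^ Suc k * 1 < real CARD('a) ^ Suc k * real CARD('a) ^ Suc k"
      by (intro mult_strict_left_mono) auto
    then have "real CARD('a) ^ Suc k < (real CARD('a) ^ Suc k) powr 2"
      using q by (simp add: powr_numeral power2_eq_square)
    then show ?thesis using v H nz by simp
  qed
  moreover have "inj ?P" by (rule injI) (simp add: monom_eq_iff')
  ultimately have "infinite ?S" by (meson finite_subset image_subsetI range_inj_infinite)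
  then show ?thesis unfolding w_exp_def by (intro Sup_upper) blast
qed

text \<open>The numbers T^(-k) have degree at most 1, distance at most max(1, |\<xi>|) from \<xi>
  and unbounded heights, while w = -2 only asks for a distance below the height.\<close>

lemma w_star_exp_ge_m2:
  assumes n: "1 \<le> n"
  shows "ereal (- 2) \<le> w_star_exp n (\<xi> :: 'a::{field,finite} fls)"
proof -
  let ?q = "real CARD('a)"
  have q: "?q > 1" using card_gt_1[where 'a='a] by simp
  let ?f = "\<lambda>k. fls_X ^ k :: 'a fls"
  have alg: "algebraic_fls (?f k)" "alg_degree (?f k) \<le> n" "1 \<le> alg_height (?f k)" for k
  proof -
    let ?P = "[:- 1, monom 1 k:] :: 'a poly poly"
    have "fls_of_poly_T (monom 1 k) = fls_X_inv ^ k"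
      by (rule fls_eqI) (auto simp: fls_of_poly_T_nth)
    then have "eval_fls ?P (?f k) = fls_X ^ k * fls_X_inv ^ k - 1"
      by (simp add: eval_fls_pCons fls_of_poly_T.hom_uminus)
    also have "\<dots> = 0" by (simp add: fls_X_inv_power_times_conv_shift mult.commute[of "fls_X ^ k"] fls_X_power_conv_shift_1)
    finally have P: "?P \<noteq> 0" "eval_fls ?P (?f k) = 0" by simp_all
    show "algebraic_fls (?f k)" unfolding algebraic_fls_def using P by (intro exI conjI)
    show "1 \<le> alg_height (?f k)" by (rule alg_degree_height_le[OF P])
    have "degree ?P \<le> 1" by simp
    then show "alg_degree (?f k) \<le> n" using alg_degree_height_le(1)[OF P] n by linarith
  qed
  let ?M = "max 1 (abs_fls \<xi>)"
  let ?B = "{\<alpha>. algebraic_fls \<alpha> \<and> alg_degree \<alpha> \<le> n \<and> alg_height \<alpha> \<le> ?M}"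
  let ?S = "{\<alpha>. algebraic_fls \<alpha> \<and> alg_degree \<alpha> \<le> n \<and> 0 < abs_fls (\<xi> - \<alpha>) \<and>
       abs_fls (\<xi> - \<alpha>) < alg_height \<alpha> powr (- (- 2) - 1)}"
  have "inj ?f"
  proof (rule injI)
    fix k l :: nat assume "?f k = ?f l"
    then have "fls_subdegree (?f k) = fls_subdegree (?f l)" by simp
    then show "k = l" by simp
  qed
  then have "infinite (range ?f)" by (rule range_inj_infinite)
  then have "infinite (range ?f - ?B - {\<xi>})"
    using finite_bounded_alg_height[of n ?M] by (intro Diff_infinite_finite) auto
  moreover have "range ?f - ?B - {\<xi>} \<subseteq> ?S"
  proof
    fix \<alpha> assume \<alpha>: "\<alpha> \<in> range ?f - ?B - {\<xi>}"
    then obtain k where k: "\<alpha> = ?f k" by auto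
    have "abs_fls (\<xi> - \<alpha>) \<le> max (abs_fls \<xi>) (abs_fls (- \<alpha>))"
      using abs_fls_add_le[of \<xi> "- \<alpha>"] by simp
    also have "abs_fls (- \<alpha>) \<le> 1"
      using q power_int_le_iff[of ?q "- int k" 0] by (simp add: k abs_fls_def)
    finally have "abs_fls (\<xi> - \<alpha>) \<le> ?M" by (simp add: max.commute)
    also have "\<dots> < alg_height \<alpha>" using \<alpha> alg k by auto
    also have "\<dots> = alg_height \<alpha> powr (- (- 2) - 1)" using alg(3)[of k] k by simp
    finally show "\<alpha> \<in> ?S" using \<alpha> alg k by auto
  qed
  ultimately have "infinite ?S" using finite_subset by blast
  then show ?thesis unfolding w_star_exp_def by (intro Sup_upper) blast
qed

text \<open>The minimal polynomial F vanishes at \<xi>, so its resultant with P bounds |P(\<xi>)|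
  from below by a constant times H(P)^(1 - d), d = deg F. The bound d is independent of n and
  disappears after division by n.\<close>

lemma w_exp_algebraic:
  fixes \<xi> :: "'a::{field,finite} fls"
  assumes "algebraic_fls \<xi>"
  shows "w_exp n \<xi> \<le> ereal (real (alg_degree \<xi>))"
proof (rule ccontr)
  define F where "F = min_poly_fls \<xi>"
  have F: "prime_elem F" "F \<noteq> 0" "eval_fls F \<xi> = 0"
    unfolding F_def by (rule algebraic_min_poly[OF assms])+
  have deg: "0 < degree F" by (rule prime_root_dvd(1)[OF F(1,3,3)])
  let ?d = "degree F" and ?M = "max 1 (abs_fls \<xi>)"
  assume "\<not> ?thesis"
  then have "ereal (real ?d) < w_exp n \<xi>" by (simp add: alg_degree_def F_def)
  then have small: "small_values n \<xi> (real ?d)" by (rule small_values_of_w_exp)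
  define A where "A = ?M ^ ?d * poly_height F"
  have A: "1 \<le> A"
    unfolding A_def using mult_mono[of 1 "?M ^ ?d" 1 "poly_height F"] poly_height_ge_1[OF F(2)] by simp
  define e where "e = 1 / (A ^ n * (?M ^ n) ^ (?d - 1))"
  have "0 < e" using A by (simp add: e_def zero_less_mult_iff)
  then obtain P where P: "degree P \<le> n" "eval_fls P \<xi> \<noteq> 0"
    "abs_fls (eval_fls P \<xi>) * poly_height P powr real ?d < e"
    using small unfolding small_values_def by blast
  let ?v = "abs_fls (eval_fls P \<xi>)" and ?H = "poly_height P"
  define B where "B = ?M ^ n * ?H"
  have H: "1 \<le> ?H" by (rule poly_height_ge_1[OF poly_nonzero_of_eval[OF P(2)]])
  have B: "1 \<le> B" unfolding B_def using mult_mono[of 1 "?M ^ n" 1 ?H] H by simp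
  have "\<not> F dvd P" using P(2) F(3) by (auto simp: eval_fls_mult)
  then have "1 \<le> A ^ degree P * B ^ ?d * (?v / B)"
  proof (rule resultant_inequality_values[OF F(1) deg, where \<xi> = \<xi>])
    show "abs_fls (coeff (taylor F \<xi>) i) \<le> A" for i
      unfolding A_def by (rule abs_coeff_taylor_le) simp
    show "abs_fls (coeff (taylor P \<xi>) i) \<le> B" for i
      unfolding B_def by (rule abs_coeff_taylor_le[OF P(1)])
  qed (use A B F in auto)
  also have "\<dots> = A ^ degree P * (B ^ (?d - 1) * ?v)" using B deg by (simp add: power_diff)
  also have "\<dots> \<le> A ^ n * (B ^ (?d - 1) * ?v)"
    using A B P(1) by (intro mult_right_mono power_increasing) auto
  also have "\<dots> = A ^ n * (?M ^ n) ^ (?d - 1) * (?H ^ (?d - 1) * ?v)"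
    by (simp add: B_def power_mult_distrib)
  also have "\<dots> \<le> A ^ n * (?M ^ n) ^ (?d - 1) * (?H ^ ?d * ?v)"
    using A H by (intro mult_left_mono mult_right_mono power_increasing) auto
  also have "\<dots> < A ^ n * (?M ^ n) ^ (?d - 1) * e"
    using P(3) A H by (intro mult_strict_left_mono) (auto simp: powr_realpow mult.commute zero_less_mult_iff)
  also have "\<dots> = 1" using A by (simp add: e_def)
  finally show False by simp
qed

section \<open>From algebraic numbers near \<xi> to small values of their minimal
  polynomials\<close>

lemma infinite_min_polys:
  assumes "infinite S" "\<And>\<alpha>. \<alpha> \<in> S \<Longrightarrow> algebraic_fls \<alpha>"
  shows "infinite (min_poly_fls ` S)"
proof
  assume fin: "finite (min_poly_fls ` S)"
  have "S \<subseteq> (\<Union>P\<in>min_poly_fls ` S. {\<alpha>. eval_fls P \<alpha> = 0})"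
    using algebraic_min_poly(3) assms(2) by blast
  moreover have "finite (\<Union>P\<in>min_poly_fls ` S. {\<alpha>. eval_fls P \<alpha> = 0})"
    using fin algebraic_min_poly(2) assms(2) by (intro finite_UN_I finite_roots) auto
  ultimately show False using assms(1) finite_subset by blast
qed

lemma abs_eval_fls_le_of_root:
  assumes P: "degree P \<le> n" "eval_fls P \<alpha> = 0" and near: "abs_fls (\<xi> - \<alpha>) \<le> 1"
  shows "abs_fls (eval_fls P \<xi>) \<le> max 1 (abs_fls \<xi>) ^ n * poly_height P * abs_fls (\<xi> - \<alpha>)"
proof -
  let ?y = "\<alpha> - \<xi>"
  have y: "abs_fls ?y = abs_fls (\<xi> - \<alpha>)" by (metis abs_fls_minus minus_diff_eq)
  have "{..degree P} = insert 0 {1..degree P}" by auto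
  then have "poly (taylor P \<xi>) ?y = eval_fls P \<xi> + (\<Sum>i=1..degree P. coeff (taylor P \<xi>) i * ?y ^ i)"
    by (simp add: poly_altdef coeff_taylor_0)
  moreover have "poly (taylor P \<xi>) ?y = 0" using P(2) by (simp add: poly_taylor)
  ultimately have "eval_fls P \<xi> = - (\<Sum>i=1..degree P. coeff (taylor P \<xi>) i * ?y ^ i)"
    by (simp add: eq_neg_iff_add_eq_0)
  also have "abs_fls \<dots> \<le> max 1 (abs_fls \<xi>) ^ n * poly_height P * abs_fls (\<xi> - \<alpha>)"
    unfolding abs_fls_minus
  proof (rule abs_fls_sum_le)
    fix i assume "i \<in> {1..degree P}"
    then have "abs_fls (?y ^ i) \<le> abs_fls (\<xi> - \<alpha>)"
      using near power_decreasing[of 1 i "abs_fls (\<xi> - \<alpha>)"] by (simp add: abs_fls_power y)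
    then show "abs_fls (coeff (taylor P \<xi>) i * ?y ^ i) \<le> max 1 (abs_fls \<xi>) ^ n * poly_height P * abs_fls (\<xi> - \<alpha>)"
      unfolding abs_fls_mult by (intro mult_mono abs_coeff_taylor_le[OF P(1)]) auto
  qed simp
  finally show ?thesis .
qed

text \<open>For w > 0 all but finitely many approximations satisfy |\<xi> - \<alpha>| \<le> 1, as
  the Taylor estimate of P(\<xi>) requires; the maximum with 0 covers the other w.\<close>

lemma w_star_exp_le:
  fixes \<xi> :: "'a::{field,finite} fls"
  shows "w_star_exp n \<xi> \<le> max 0 (w_exp n \<xi>)"
  unfolding w_star_exp_def
proof (rule Sup_least)
  fix x assume "x \<in> {ereal w | w. infinite {\<alpha>. algebraic_fls \<alpha> \<and> alg_degree \<alpha> \<le> n \<and>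
       0 < abs_fls (\<xi> - \<alpha>) \<and> abs_fls (\<xi> - \<alpha>) < alg_height \<alpha> powr (- w - 1)}}"
  then obtain w where x: "x = ereal w" and inf: "infinite {\<alpha>. algebraic_fls \<alpha> \<and> alg_degree \<alpha> \<le> n \<and>
       0 < abs_fls (\<xi> - \<alpha>) \<and> abs_fls (\<xi> - \<alpha>) < alg_height \<alpha> powr (- w - 1)}" (is "infinite ?S")
    by blast
  show "x \<le> max 0 (w_exp n \<xi>)"
  proof (cases "w \<le> 0")
    case True
    then show ?thesis by (simp add: x le_max_iff_disj)
  next
    case False
    have "ereal w \<le> w_exp n \<xi>"
    proof (rule w_exp_ge)
      fix w' assume w': "w' < w"
      let ?C = "max 1 (abs_fls \<xi>) ^ n"
      have C: "1 \<le> ?C" by simp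
      obtain B0 where B0: "1 \<le> B0" "\<And>H. B0 < H \<Longrightarrow> H powr (- (w - w')) < 1 / ?C"
        using eventually_powr_less[of "w - w'" "1 / ?C"] w' C by auto
      \<comment> \<open>Beyond the height of \<xi> the minimal polynomial of \<alpha> cannot vanish
        at \<xi>, since it would divide that of \<xi>. For transcendental \<xi> the number
        \<open>alg_height \<xi>\<close> is an unspecified real, which does no harm.\<close>
      define B where "B = max B0 (alg_height \<xi>)"
      let ?B = "{\<alpha>. algebraic_fls \<alpha> \<and> alg_degree \<alpha> \<le> n \<and> alg_height \<alpha> \<le> B}"
      have "infinite (?S - ?B)"
        using finite_bounded_alg_height inf by (rule Diff_infinite_finite)
      then have "infinite (min_poly_fls ` (?S - ?B))" by (rule infinite_min_polys) blast
      moreover have "min_poly_fls ` (?S - ?B) \<subseteq> {P. degree P \<le> n \<and> 0 < abs_fls (eval_fls P \<xi>) \<and>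
          abs_fls (eval_fls P \<xi>) < poly_height P powr (- w')}"
      proof (intro image_subsetI)
        fix \<alpha> assume "\<alpha> \<in> ?S - ?B"
        then have \<alpha>: "algebraic_fls \<alpha>" "alg_degree \<alpha> \<le> n" "B < alg_height \<alpha>"
          "abs_fls (\<xi> - \<alpha>) < alg_height \<alpha> powr (- w - 1)" by auto
        define P where "P = min_poly_fls \<alpha>"
        have P: "prime_elem P" "P \<noteq> 0" "eval_fls P \<alpha> = 0" "degree P \<le> n" "poly_height P = alg_height \<alpha>"
          using algebraic_min_poly[OF \<alpha>(1)] \<alpha>(2) by (simp_all add: P_def alg_degree_def alg_height_def)
        let ?H = "poly_height P"
        have H: "B0 < ?H" "alg_height \<xi> < ?H" "1 < ?H" using \<alpha>(3) P(5) B0(1) by (auto simp: B_def)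
        have nz: "eval_fls P \<xi> \<noteq> 0"
        proof
          assume root: "eval_fls P \<xi> = 0"
          then have alg: "algebraic_fls \<xi>" using P(2) by (auto simp: algebraic_fls_def)
          note m = algebraic_min_poly[OF alg]
          have "P dvd min_poly_fls \<xi>" by (rule prime_root_dvd(2)[OF P(1) root m(3)])
          then have "?H \<le> alg_height \<xi>" unfolding alg_height_def using m(2) by (rule poly_height_dvd_le)
          with H show False by simp
        qed
        have near: "abs_fls (\<xi> - \<alpha>) < ?H powr (- w - 1)" using \<alpha>(4) P(5) by simp
        have "?H powr (- w - 1) \<le> 1" using powr_mono[of "- w - 1" 0 ?H] H False by simp
        with near have "abs_fls (\<xi> - \<alpha>) \<le> 1" by simp
        then have "abs_fls (eval_fls P \<xi>) \<le> ?C * ?H * abs_fls (\<xi> - \<alpha>)"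
          by (rule abs_eval_fls_le_of_root[OF P(4,3)])
        also have "\<dots> \<le> ?C * ?H * ?H powr (- w - 1)"
          using near H C by (intro mult_left_mono) auto
        also have "\<dots> = ?C * (?H powr (- (w - w')) * ?H powr (- w'))"
          using H by (simp add: powr_diff powr_minus field_simps flip: powr_add)
        also have "\<dots> < ?C * (1 / ?C * ?H powr (- w'))"
          using B0(2)[OF H(1)] C H by (intro mult_strict_left_mono mult_strict_right_mono) auto
        also have "\<dots> = ?H powr (- w')" using C by simp
        finally show "min_poly_fls \<alpha> \<in> {P. degree P \<le> n \<and> 0 < abs_fls (eval_fls P \<xi>) \<and>
          abs_fls (eval_fls P \<xi>) < poly_height P powr (- w')}"
          using P(4) nz by (simp add: P_def)
      qed
      ultimately show "infinite {P. degree P \<le> n \<and> 0 < abs_fls (eval_fls P \<xi>) \<and>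
          abs_fls (eval_fls P \<xi>) < poly_height P powr (- w')}" using finite_subset by blast
    qed
    then show ?thesis by (simp add: x le_max_iff_disj)
  qed
qed

section \<open>Comparing the classes\<close>

lemma ereal_divide_le_iff:
  assumes "1 \<le> n"
  shows "x / ereal (real n) \<le> ereal c \<longleftrightarrow> x \<le> ereal (c * real n)"
    and "ereal c \<le> x / ereal (real n) \<longleftrightarrow> ereal (c * real n) \<le> x"
  using assms by (cases x; simp add: divide_simps)+

lemma exp_growth_leI:
  assumes "\<forall>\<^sub>F n in sequentially. v n \<xi> \<le> ereal (c * real n)"
  shows "exp_growth v \<xi> \<le> ereal c"
  unfolding exp_growth_def
proof (rule Limsup_bounded)
  show "\<forall>\<^sub>F n in sequentially. v n \<xi> / ereal (real n) \<le> ereal c"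
    using assms eventually_ge_at_top[of "1 :: nat"] by eventually_elim (simp add: ereal_divide_le_iff)
qed

lemma exp_growth_geI:
  assumes "\<exists>\<^sub>F n in sequentially. ereal (c * real n) \<le> v n \<xi>"
  shows "ereal c \<le> exp_growth v \<xi>"
proof (rule ccontr)
  assume "\<not> ?thesis"
  then have "\<forall>\<^sub>F n in sequentially. v n \<xi> / ereal (real n) < ereal c"
    unfolding exp_growth_def by (intro Limsup_lessD) simp
  then have "\<forall>\<^sub>F n in sequentially. \<not> ereal (c * real n) \<le> v n \<xi>"
    using eventually_ge_at_top[of "1 :: nat"]
    by eventually_elim (simp add: not_le[symmetric] ereal_divide_le_iff)
  with assms show False by (simp add: frequently_def)
qed

lemma exp_growth_lessD:
  assumes "exp_growth v \<xi> < ereal c"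
  shows "\<forall>\<^sub>F n in sequentially. v n \<xi> \<le> ereal (c * real n)"
proof -
  have "\<forall>\<^sub>F n in sequentially. v n \<xi> / ereal (real n) < ereal c"
    using assms unfolding exp_growth_def by (rule Limsup_lessD)
  then show ?thesis
    using eventually_ge_at_top[of "1 :: nat"]
    by eventually_elim (simp add: ereal_divide_le_iff less_imp_le flip: ereal_divide_le_iff(1))
qed

lemma exp_growth_nonneg:
  assumes "\<And>n. 1 \<le> n \<Longrightarrow> ereal (- 2) \<le> v n \<xi>"
  shows "0 \<le> exp_growth v \<xi>"
proof (rule ccontr)
  assume "\<not> ?thesis"
  then have "exp_growth v \<xi> < ereal 0" by (simp add: zero_ereal_def)
  then obtain c where c: "exp_growth v \<xi> < ereal c" "ereal c < ereal 0" using ereal_dense2 by blast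
  have "\<forall>\<^sub>F n in sequentially. - 2 > c * real n"
    using c(2) by real_asymp
  with exp_growth_lessD[OF c(1)] eventually_ge_at_top[of "1 :: nat"]
  have "\<forall>\<^sub>F n :: nat in sequentially. False"
  proof eventually_elim
    case (elim n)
    from assms[OF elim(2)] elim(1) have "ereal (- 2) \<le> ereal (c * real n)" by (rule order_trans)
    with elim(3) show False by simp
  qed
  then show False by simp
qed

text \<open>The maximum with 0 disappears in the limit: the growth of w_n is nonnegative, so any c
  above it is positive.\<close>

lemma exp_growth_star_le:
  "exp_growth w_star_exp (\<xi> :: 'a::{field,finite} fls) \<le> exp_growth w_exp \<xi>"
proof (rule ccontr)
  assume "\<not> ?thesis"
  then obtain c where c: "exp_growth w_exp \<xi> < ereal c" "ereal c < exp_growth w_star_exp \<xi>"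
    using ereal_dense2 by (auto simp: not_le)
  have "0 \<le> exp_growth w_exp \<xi>" by (intro exp_growth_nonneg w_exp_ge_m2)
  with c(1) have "0 < c" by (metis ereal_less(2) order_le_less_trans)
  have "exp_growth w_star_exp \<xi> \<le> ereal c"
  proof (rule exp_growth_leI)
    show "\<forall>\<^sub>F n in sequentially. w_star_exp n \<xi> \<le> ereal (c * real n)"
      using exp_growth_lessD[OF c(1)]
    proof eventually_elim
      case (elim n)
      have "w_star_exp n \<xi> \<le> max 0 (w_exp n \<xi>)" by (rule w_star_exp_le)
      also have "\<dots> \<le> ereal (c * real n)" using elim \<open>0 < c\<close> by simp
      finally show ?case .
    qed
  qed
  with c(2) show False by simp
qed

lemma w_star_exp_ge_half:
  assumes n: "1 \<le> n" and w: "4 * real n \<le> w" and less: "ereal w < w_exp n (\<xi> :: 'a::{field,finite} fls)"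
  shows "ereal ((w - 1) / 2) \<le> w_star_exp n \<xi>"
  by (rule w_star_exp_ge_of_large_w[OF n w small_values_of_w_exp[OF less]])

lemma w_star_exp_eq_infinity_iff:
  assumes "1 \<le> n"
  shows "w_star_exp n \<xi> = \<infinity> \<longleftrightarrow> w_exp n (\<xi> :: 'a::{field,finite} fls) = \<infinity>"
proof
  assume "w_star_exp n \<xi> = \<infinity>"
  with w_star_exp_le[of n \<xi>] show "w_exp n \<xi> = \<infinity>" by (simp add: max_def split: if_splits)
next
  assume inf: "w_exp n \<xi> = \<infinity>"
  show "w_star_exp n \<xi> = \<infinity>"
  proof (rule ereal_top)
    fix B :: real
    \<comment> \<open>The first entry reaches the range of \<open>w_star_exp_ge_half\<close>, the
      second makes (w - 1) / 2 at least B.\<close>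
    define w where "w = max (4 * real n) (2 * B + 1)"
    then have w: "4 * real n \<le> w" "2 * B + 1 \<le> w" by simp_all
    then have "ereal B \<le> ereal ((w - 1) / 2)" by simp
    also have "\<dots> \<le> w_star_exp n \<xi>"
      using assms inf w by (intro w_star_exp_ge_half) simp_all
    finally show "ereal B \<le> w_star_exp n \<xi>" .
  qed
qed

lemma exp_growth_star_eq_infinity_iff:
  "exp_growth w_star_exp \<xi> = \<infinity> \<longleftrightarrow> exp_growth w_exp (\<xi> :: 'a::{field,finite} fls) = \<infinity>"
proof
  assume "exp_growth w_star_exp \<xi> = \<infinity>"
  with exp_growth_star_le[of \<xi>] show "exp_growth w_exp \<xi> = \<infinity>" by simp
next
  assume inf: "exp_growth w_exp \<xi> = \<infinity>"
  show "exp_growth w_star_exp \<xi> = \<infinity>"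
  proof (rule ereal_top)
    fix B :: real
    \<comment> \<open>The entry 4 puts c n in the range of \<open>w_star_exp_ge_half\<close>; 2 B +
      1 gives (c n - 1) / 2 \<ge> B n for n \<ge> 1.\<close>
    define c where "c = max 4 (2 * B + 1)"
    then have c: "4 \<le> c" "2 * B + 1 \<le> c" by simp_all
    have "\<exists>\<^sub>F n in sequentially. ereal (c * real n) < w_exp n \<xi>"
    proof (rule ccontr)
      assume "\<not> ?thesis"
      then have "\<forall>\<^sub>F n in sequentially. w_exp n \<xi> \<le> ereal (c * real n)"
        by (simp add: not_frequently not_less)
      then have "exp_growth w_exp \<xi> \<le> ereal c" by (rule exp_growth_leI)
      with inf show False by simp
    qed
    then have "\<exists>\<^sub>F n in sequentially. ereal (c * real n) < w_exp n \<xi> \<and> 1 \<le> n"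
      using eventually_ge_at_top[of "1 :: nat"] by (rule frequently_eventually_frequently)
    then have "\<exists>\<^sub>F n in sequentially. ereal (B * real n) \<le> w_star_exp n \<xi>"
    proof (rule frequently_elim1)
      fix n :: nat assume n: "ereal (c * real n) < w_exp n \<xi> \<and> 1 \<le> n"
      have "(2 * B + 1) * real n \<le> c * real n" using c by (intro mult_right_mono) auto
      moreover have "1 \<le> real n" using n by simp
      ultimately have "B * real n \<le> (c * real n - 1) / 2" by (simp add: algebra_simps)
      then have "ereal (B * real n) \<le> ereal ((c * real n - 1) / 2)" by simp
      also have "\<dots> \<le> w_star_exp n \<xi>"
        using n c by (intro w_star_exp_ge_half mult_right_mono) auto
      finally show "ereal (B * real n) \<le> w_star_exp n \<xi>" .
    qed
    then show "ereal B \<le> exp_growth w_star_exp \<xi>" by (rule exp_growth_geI)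
  qed
qed

lemma exp_growth_algebraic:
  assumes "algebraic_fls (\<xi> :: 'a::{field,finite} fls)"
  shows "exp_growth w_exp \<xi> \<le> 0"
proof (rule ccontr)
  assume "\<not> ?thesis"
  then obtain c where c: "ereal 0 < ereal c" "ereal c < exp_growth w_exp \<xi>"
    using ereal_dense2[of 0 "exp_growth w_exp \<xi>"] by (auto simp: not_le zero_ereal_def)
  have "\<forall>\<^sub>F n in sequentially. real (alg_degree \<xi>) \<le> c * real n"
    using c(1) by real_asymp
  then have "\<forall>\<^sub>F n in sequentially. w_exp n \<xi> \<le> ereal (c * real n)"
    by eventually_elim (use w_exp_algebraic[OF assms] in \<open>meson ereal_less_eq(3) order_trans\<close>)
  then have "exp_growth w_exp \<xi> \<le> ereal c" by (rule exp_growth_leI)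
  with c(2) show False by simp
qed

lemma exp_growth_star_transcendental:
  assumes "\<not> algebraic_fls (\<xi> :: 'a::{field,finite} fls)"
  shows "0 < exp_growth w_star_exp \<xi>"
proof -
  \<comment> \<open>From n = 4 on, n / 2 - 1 is at least n / 4.\<close>
  have "\<forall>\<^sub>F n in sequentially. ereal (1 / 4 * real n) \<le> w_star_exp n \<xi>"
    using eventually_ge_at_top[of "4 :: nat"]
  proof eventually_elim
    case (elim n)
    then have "ereal (1 / 4 * real n) \<le> ereal (real n / 2 - 1)" by simp
    also have "\<dots> \<le> w_star_exp n \<xi>"
      using elim by (intro w_star_exp_ge_of_transcendental[OF assms]) simp
    finally show ?case .
  qed
  then have "\<exists>\<^sub>F n in sequentially. ereal (1 / 4 * real n) \<le> w_star_exp n \<xi>"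
    by (intro eventually_frequently) simp_all
  then have "ereal (1 / 4) \<le> exp_growth w_star_exp \<xi>" by (rule exp_growth_geI)
  then show ?thesis by (rule less_le_trans[rotated]) simp
qed

lemma exp_growth_eq_0_iff:
  "exp_growth w_star_exp \<xi> = 0 \<longleftrightarrow> exp_growth w_exp (\<xi> :: 'a::{field,finite} fls) = 0"
proof -
  have nonneg: "0 \<le> exp_growth w_star_exp \<xi>"
    by (intro exp_growth_nonneg w_star_exp_ge_m2)
  show ?thesis
  proof (cases "algebraic_fls \<xi>")
    case True
    from exp_growth_algebraic[OF this] nonneg exp_growth_star_le[of \<xi>] show ?thesis by force
  next
    case False
    from exp_growth_star_transcendental[OF this] exp_growth_star_le[of \<xi>] show ?thesis by auto
  qed
qed

theorem theorem1p4:
  fixes p q :: nat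
  assumes "prime p"
    and "\<exists>e\<ge>1. q = p ^ e"
    and "CARD('a::{field,finite}) = q"
  shows "A_class w_exp = (A_class w_star_exp :: 'a fls set)
       \<and> S_class w_exp = (S_class w_star_exp :: 'a fls set)
       \<and> T_class w_exp = (T_class w_star_exp :: 'a fls set)
       \<and> U_class w_exp = (U_class w_star_exp :: 'a fls set)"
proof -
  have nonneg: "0 \<le> exp_growth w_exp \<xi>" "0 \<le> exp_growth w_star_exp \<xi>" for \<xi> :: "'a fls"
    by (auto intro!: exp_growth_nonneg w_exp_ge_m2 w_star_exp_ge_m2)
  note zero = exp_growth_eq_0_iff and infinity = exp_growth_star_eq_infinity_iff
  \<comment> \<open>Both limits are nonnegative, vanish together and are infinite together, so they
    are positive and finite together.\<close>
  have S: "0 < exp_growth w_exp \<xi> \<and> exp_growth w_exp \<xi> < \<infinity> \<longleftrightarrow>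
      0 < exp_growth w_star_exp \<xi> \<and> exp_growth w_star_exp \<xi> < \<infinity>" for \<xi> :: "'a fls"
    using nonneg[of \<xi>] zero[of \<xi>] infinity[of \<xi>] by (auto simp: order.strict_iff_order)
  have fin: "w_star_exp n \<xi> < \<infinity> \<longleftrightarrow> w_exp n \<xi> < \<infinity>" if "1 \<le> n" for n and \<xi> :: "'a fls"
    using w_star_exp_eq_infinity_iff[OF that, of \<xi>] by simp
  have "A_class w_exp = (A_class w_star_exp :: 'a fls set)"
    unfolding A_class_def by (simp only: zero)
  moreover have "S_class w_exp = (S_class w_star_exp :: 'a fls set)"
    unfolding S_class_def by (simp only: S)
  moreover have "T_class w_exp = (T_class w_star_exp :: 'a fls set)"
    unfolding T_class_def by (simp only: infinity fin cong: conj_cong imp_cong)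
  moreover have "U_class w_exp = (U_class w_star_exp :: 'a fls set)"
    unfolding U_class_def by (simp only: infinity w_star_exp_eq_infinity_iff cong: conj_cong)
  ultimately show ?thesis by blast
qed

end
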